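(* Let $f \in L(\mathbb{R}^2)$ be piecewise smooth. Then for all $x \in \mathbb{R}^2$, $$\lim_{\alpha \rightarrow 0} A_\alpha f(x) = Sf(x),$$ where $\alpha$ ranges over positive reals.
   Context: $L(\mathbb{R}^2)$ denotes the space of (Lebesgue) integrable functions on $\mathbb{R}^2$; functions are complex-valued unless stated otherwise. Piecewise smooth functions: a function $f$ is a simple piecewise smooth function if $f(x) = F(x)\chi_D(x)$, where $F$ is differentiable on $\mathbb{R}^2$, $D \subset \mathbb{R}^2$ has a piecewise smooth boundary that does not intersect itself, and $\chi_D(x) = 1$ if $x \in D \cup \partial D$, $\chi_D(x) = 0$ if $x \notin D\cup\partial D$. A function is piecewise smooth if it is a finite linear combination of simple piecewise smooth functions. Radon transform: for $f\in L(\mathbb{R}^2)$, $0\le\psi<\pi$ and $t \in \mathbb{R}$, $$Rf(t,\psi) = \int_{-\infty}^\infty f(t\cos\psi - u\sin\psi,\ t\sin\psi + u\cos\psi)\, du,$$ i.e. the integral of $f$ over the line orthogonal to the unit vector $\mathbf{n} = (\cos\psi,\sin\psi)$ and passing through $t\mathbf{n}$. By Fubini's theorem it exists for almost all $\psi\in[0,\pi)$ and $t\in\mathbb{R}$. Operator $A_\alpha$: for $\alpha>0$ and $x=(x_1,x_2)\in\mathbb{R}^2$, $$A_\alpha f(x) = \int_0^\pi d\psi \int_{-\infty}^\infty \Phi_\alpha(x,t,\psi)\, Rf(t,\psi)\, dt,$$ $$\Phi_\alpha(x,t,\psi) = \frac{1}{2\pi^2}\,\frac{\alpha^2 - (x_1\cos\psi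 + x_2\sin\psi - t)^2}{[\alpha^2 + (x_1\cos\psi + x_2\sin\psi - t)^2]^2}.$$ Local averages: for a piecewise smooth function $f$ and $r>0$, $$S_r f(x) = \frac{1}{2\pi}\int_0^{2\pi} f(x_1 + r\cos\theta, x_2 + r\sin\theta)\, d\theta, \qquad Sf(x) = \lim_{r\to 0} S_r f(x);$$ this limit exists for every piecewise smooth $f$ and every $x\in\mathbb{R}^2$. *)

theory Defs
  imports "HOL-Analysis.Analysis"
begin

text \<open>The plane is \<^typ>\<open>real \<times> real\<close>.\<close>

section \<open>Piecewise smooth functions\<close>

text \<open>
  Smooth arcs are continuously differentiable with nowhere vanishing velocity. The derivative at the
  end points is one-sided, whence \<open>at t within {c..d}\<close>; this is why the library notion
  \<^const>\<open>C1_differentiable_on\<close>, which uses two-sided derivatives, is not used.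
\<close>

definition smooth_arc_on :: "real \<Rightarrow> real \<Rightarrow> (real \<Rightarrow> real \<times> real) \<Rightarrow> bool" where
  "smooth_arc_on c d \<gamma> \<longleftrightarrow>
     (\<exists>\<gamma>'. continuous_on {c..d} \<gamma>' \<and>
        (\<forall>t\<in>{c..d}. (\<gamma> has_vector_derivative \<gamma>' t) (at t within {c..d}) \<and> \<gamma>' t \<noteq> 0))"

text \<open>
  The parameter interval \<open>I\<close> may be unbounded, so that unbounded boundary curves (for example
  straight lines) are covered; \<open>P\<close> is the set of parameters of corners and cusps.
\<close>

definition piecewise_smooth_curve_on :: "real set \<Rightarrow> (real \<Rightarrow> real \<times> real) \<Rightarrow> bool" where
  "piecewise_smooth_curve_on I \<gamma> \<longleftrightarrow>
     continuous_on I \<gamma> \<and>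
     (\<exists>P. (\<forall>a b. finite (P \<inter> {a..b})) \<and>
        (\<forall>c d. c < d \<and> {c..d} \<subseteq> I \<and> {c<..<d} \<inter> P = {} \<longrightarrow> smooth_arc_on c d \<gamma>))"

text \<open>
  The exception \<open>closed_segment s t = I\<close> allows the two end points of a compact parameter interval
  to coincide, i.e. closed curves. The last condition is vacuous for bounded \<open>I\<close>; otherwise it says
  that the curve tends to infinity at its unbounded ends, so that it does not accumulate anywhere.
\<close>

definition simple_piecewise_smooth_curve :: "(real \<times> real) set \<Rightarrow> bool" where
  "simple_piecewise_smooth_curve C \<longleftrightarrow>
     (\<exists>I \<gamma>. is_interval I \<and> closed I \<and> interior I \<noteq> {} \<and>
        piecewise_smooth_curve_on I \<gamma> \<and> C = \<gamma> ` I \<and>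
        (\<forall>s\<in>I. \<forall>t\<in>I. \<gamma> s = \<gamma> t \<longrightarrow> s = t \<or> closed_segment s t = I) \<and>
        (\<forall>B. bounded B \<longrightarrow> bounded {t \<in> I. \<gamma> t \<in> B}))"

text \<open>
  The boundary may have several components (as for an annulus or a strip), even infinitely many
  provided they do not accumulate, and it may be empty (as for the whole plane).
\<close>

definition piecewise_smooth_boundary :: "(real \<times> real) set \<Rightarrow> bool" where
  "piecewise_smooth_boundary D \<longleftrightarrow>
     (\<exists>\<C>. (\<forall>C\<in>\<C>. simple_piecewise_smooth_curve C) \<and> pairwise disjnt \<C> \<and>
        locally_finite_in euclidean \<C> \<and> frontier D = \<Union>\<C>)"

definition simple_piecewise_smooth :: "(real \<times> real \<Rightarrow> complex) \<Rightarrow> bool" where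
  "simple_piecewise_smooth f \<longleftrightarrow>
     (\<exists>F D. (\<forall>x. F differentiable (at x)) \<and> piecewise_smooth_boundary D \<and>
        f = (\<lambda>x. F x * indicator (D \<union> frontier D) x))"

definition piecewise_smooth :: "(real \<times> real \<Rightarrow> complex) \<Rightarrow> bool" where
  "piecewise_smooth f \<longleftrightarrow>
     (\<exists>(n::nat) c g. (\<forall>i<n. simple_piecewise_smooth (g i)) \<and> f = (\<lambda>x. \<Sum>i<n. c i * g i x))"


section \<open>The Radon transform and its approximate inversion\<close>

definition radon :: "(real \<times> real \<Rightarrow> complex) \<Rightarrow> real \<Rightarrow> real \<Rightarrow> complex" where
  "radon f t \<psi> = (LINT u|lebesgue. f (t * cos \<psi> - u * sin \<psi>, t * sin \<psi> + u * cos \<psi>))"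

definition Phi :: "real \<Rightarrow> real \<times> real \<Rightarrow> real \<Rightarrow> real \<Rightarrow> real" where
  "Phi \<alpha> x t \<psi> =
     1 / (2 * pi\<^sup>2) * ((\<alpha>\<^sup>2 - (fst x * cos \<psi> + snd x * sin \<psi> - t)\<^sup>2) /
       (\<alpha>\<^sup>2 + (fst x * cos \<psi> + snd x * sin \<psi> - t)\<^sup>2)\<^sup>2)"

definition A_op :: "real \<Rightarrow> (real \<times> real \<Rightarrow> complex) \<Rightarrow> real \<times> real \<Rightarrow> complex" where
  "A_op \<alpha> f x =
     (LINT \<psi>:{0..<pi}|lebesgue. (LINT t|lebesgue. complex_of_real (Phi \<alpha> x t \<psi>) * radon f t \<psi>))"


section \<open>Local averages\<close>

definition circle_average :: "real \<Rightarrow> (real \<times> real \<Rightarrow> complex) \<Rightarrow> real \<times> real \<Rightarrow> complex" where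
  "circle_average r f x =
     1 / (2 * complex_of_real pi) *
       (LINT \<theta>:{0..2*pi}|lebesgue. f (fst x + r * cos \<theta>, snd x + r * sin \<theta>))"

definition local_average :: "(real \<times> real \<Rightarrow> complex) \<Rightarrow> real \<times> real \<Rightarrow> complex" where
  "local_average f x = Lim (at_right 0) (\<lambda>r. circle_average r f x)"

end

theory Submission
  imports Defs "HOL-Real_Asymp.Real_Asymp"
begin

text \<open>
  The idea is that \<open>A_op \<alpha> f\<close> is the Poisson integral of \<open>f\<close> at height \<open>\<alpha>\<close> above the plane. By Fubini's
  theorem and the rotation invariance of Lebesgue measure, the inner integral of \<open>Phi\<close> against the
  Radon transform is an integral of \<open>f\<close> against a plane wave, and integrating the plane waves over
  all directions gives
  \<open>A_op \<alpha> f x = \<integral> K\<^sub>\<alpha> (x - y) f(y) dy\<close> with \<open>K\<^sub>\<alpha> z = \<alpha> / (2 pi (\<alpha>\<^sup>2 + |z|\<^sup>2) ^ (3/2))\<close>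
  (lemma \<open>A_op_eq_poisson_integral\<close>, which rests on the elementary but not obvious integral in
  \<open>angular_integral\<close>).

  The kernel \<open>K\<^sub>\<alpha>\<close> is radial, so averaging over rotations about \<open>x\<close> replaces \<open>f (x + z)\<close> by the circle
  average of radius \<open>|z|\<close> (\<open>A_op_eq_rotation_average\<close>). As \<open>K\<^sub>\<alpha>\<close> is positive, has mass 1 and concentrates
  at the origin, the integral tends to the limit of the circle averages at radius 0, as soon as
  that limit exists (\<open>poisson_kernel_approximate_identity\<close>).

  The limit exists for piecewise smooth functions by the following geometric observation. A piecewise
  smooth boundary curve has at most two one-sided tangents for each of its passages through \<open>x\<close>, and a
  ray from \<open>x\<close> in none of their directions does not meet the curve near \<open>x\<close>, except at \<open>x\<close> itself
  (\<open>eventually_ray_avoids_curve\<close>). Near \<open>x\<close>, such a ray therefore stays inside or stays outside the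
  region \<open>D\<close>, so \<open>f\<close> has a limit at \<open>x\<close> along all but finitely many rays, and dominated convergence
  applies to the circle averages (\<open>circle_average_converges\<close>).
\<close>

section \<open>Rotation invariance of planar Lebesgue measure\<close>

text \<open>
  Testing against nonnegative functions, instead of against sets, makes Fubini's theorem and the
  affine substitution rules on the line applicable when \<open>T\<close> is a shear.
\<close>

lemma lborel_distr_eqI:
  fixes T :: "'a::euclidean_space \<Rightarrow> 'a"
  assumes [measurable]: "T \<in> borel_measurable borel"
    and eq: "\<And>g::'a \<Rightarrow> ennreal. g \<in> borel_measurable borel \<Longrightarrow> (\<integral>\<^sup>+z. g (T z) \<partial>lborel) = (\<integral>\<^sup>+z. g z \<partial>lborel)"
  shows "distr lborel borel T = lborel"
proof (rule measure_eqI)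
  fix A assume "A \<in> sets (distr lborel borel T)"
  then have A [measurable]: "A \<in> sets borel" by simp
  have "emeasure (distr lborel borel T) A = (\<integral>\<^sup>+z. indicator A z \<partial>distr lborel borel T)"
    by simp
  also have "\<dots> = (\<integral>\<^sup>+z. indicator A (T z) \<partial>lborel)"
    by (rule nn_integral_distr) auto
  also have "\<dots> = (\<integral>\<^sup>+z. indicator A z \<partial>lborel)" by (rule eq) auto
  finally show "emeasure (distr lborel borel T) A = emeasure lborel A" by simp
qed simp

text \<open>
  A horizontal shear translates every horizontal line within itself, so Fubini's theorem, with the
  integral along these lines innermost, reduces the invariance under the shear to the translation invariance of Lebesgue measure on the line.
\<close>

lemma lborel_distr_shear_fst:
  "distr lborel borel (\<lambda>z::real\<times>real. (fst z + k * snd z, snd z)) = lborel"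
proof (rule lborel_distr_eqI)
  fix g :: "real \<times> real \<Rightarrow> ennreal" assume [measurable]: "g \<in> borel_measurable borel"
  have "(\<integral>\<^sup>+z. g (fst z + k * snd z, snd z) \<partial>lborel)
      = (\<integral>\<^sup>+y. (\<integral>\<^sup>+x. g (x + k * y, y) \<partial>lborel) \<partial>lborel)"
    by (simp add: lborel_pair.nn_integral_snd[symmetric] flip: lborel_prod)
  also have "\<dots> = (\<integral>\<^sup>+y. (\<integral>\<^sup>+x. g (x, y) \<partial>lborel) \<partial>lborel)"
  proof (rule nn_integral_cong)
    fix y :: real
    show "(\<integral>\<^sup>+x. g (x + k * y, y) \<partial>lborel) = (\<integral>\<^sup>+x. g (x, y) \<partial>lborel)"
      using nn_integral_real_affine[of "\<lambda>x. g (x, y)" 1 "k * y"] by (simp add: add.commute)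
  qed
  also have "\<dots> = (\<integral>\<^sup>+z. g z \<partial>lborel)"
    using lborel_pair.nn_integral_snd[of g] by (simp add: lborel_prod)
  finally show "(\<integral>\<^sup>+z. g (fst z + k * snd z, snd z) \<partial>lborel) = (\<integral>\<^sup>+z. g z \<partial>lborel)" .
qed (intro borel_measurable_continuous_onI continuous_intros)

lemma lborel_distr_shear_snd:
  "distr lborel borel (\<lambda>z::real\<times>real. (fst z, snd z + k * fst z)) = lborel"
proof (rule lborel_distr_eqI)
  fix g :: "real \<times> real \<Rightarrow> ennreal" assume [measurable]: "g \<in> borel_measurable borel"
  have "(\<integral>\<^sup>+z. g (fst z, snd z + k * fst z) \<partial>lborel)
      = (\<integral>\<^sup>+x. (\<integral>\<^sup>+y. g (x, y + k * x) \<partial>lborel) \<partial>lborel)"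
    by (simp add: lborel.nn_integral_fst[symmetric] flip: lborel_prod)
  also have "\<dots> = (\<integral>\<^sup>+x. (\<integral>\<^sup>+y. g (x, y) \<partial>lborel) \<partial>lborel)"
  proof (rule nn_integral_cong)
    fix x :: real
    show "(\<integral>\<^sup>+y. g (x, y + k * x) \<partial>lborel) = (\<integral>\<^sup>+y. g (x, y) \<partial>lborel)"
      using nn_integral_real_affine[of "\<lambda>y. g (x, y)" 1 "k * x"] by (simp add: add.commute)
  qed
  also have "\<dots> = (\<integral>\<^sup>+z. g z \<partial>lborel)"
    using lborel.nn_integral_fst[of g lborel] by (simp add: lborel_prod)
  finally show "(\<integral>\<^sup>+z. g (fst z, snd z + k * fst z) \<partial>lborel) = (\<integral>\<^sup>+z. g z \<partial>lborel)" .
qed (intro borel_measurable_continuous_onI continuous_intros)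

definition rot :: "real \<Rightarrow> real \<times> real \<Rightarrow> real \<times> real" where
  "rot \<theta> z = (fst z * cos \<theta> - snd z * sin \<theta>, fst z * sin \<theta> + snd z * cos \<theta>)"

lemma rot_measurable [measurable]: "rot \<theta> \<in> borel_measurable borel"
  unfolding rot_def by (intro borel_measurable_continuous_onI continuous_intros)

lemma rot_rot: "rot a (rot b z) = rot (a + b) z"
  by (simp add: rot_def cos_add sin_add algebra_simps)

lemma norm_rot [simp]: "norm (rot \<theta> z) = norm z"
proof -
  have "(fst z * cos \<theta> - snd z * sin \<theta>)\<^sup>2 + (fst z * sin \<theta> + snd z * cos \<theta>)\<^sup>2
      = ((fst z)\<^sup>2 + (snd z)\<^sup>2) * ((sin \<theta>)\<^sup>2 + (cos \<theta>)\<^sup>2)"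
    by (simp only: power2_eq_square) (simp only: algebra_simps)
  then show ?thesis by (simp add: rot_def norm_prod_def)
qed

lemma lborel_distr_compose:
  assumes "distr lborel borel S = lborel" "distr lborel borel T = lborel"
    and [measurable]: "S \<in> borel_measurable borel" "T \<in> borel_measurable borel"
  shows "distr lborel borel (\<lambda>z. S (T z)) = lborel"
proof -
  have "distr lborel borel (\<lambda>z. S (T z)) = distr (distr lborel borel T) borel S"
    by (subst distr_distr) (auto simp: comp_def)
  then show ?thesis by (simp add: assms)
qed

text \<open>
  With \<open>k = - tan (\<theta> / 2)\<close>, rotation by \<open>\<theta>\<close> is a horizontal shear by \<open>k\<close>, then a vertical shear by
  \<open>sin \<theta>\<close>, then the horizontal shear again. When the tangent is undefined, the rotation is the
  square of the rotation by \<open>\<theta> / 2\<close>, for which it is defined.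
\<close>

lemma lborel_distr_rot: "distr lborel borel (rot \<theta>) = lborel"
proof -
  have shears: "distr lborel borel (rot \<theta>) = lborel" if "cos (\<theta> / 2) \<noteq> 0" for \<theta>
  proof -
    define k where "k = - (sin (\<theta> / 2) / cos (\<theta> / 2))"
    define c where "c = cos (\<theta> / 2)"
    define s where "s = sin (\<theta> / 2)"
    have sc: "s\<^sup>2 + c\<^sup>2 = 1" "c \<noteq> 0" "sin \<theta> = 2 * s * c" "cos \<theta> = c\<^sup>2 - s\<^sup>2" "k = - s / c"
      using that sin_double[of "\<theta> / 2"] cos_double[of "\<theta> / 2"]
      by (auto simp: s_def c_def k_def)
    have e1: "1 + k * sin \<theta> = cos \<theta>"
    proof -
      have "k * sin \<theta> = - 2 * s\<^sup>2" using sc by (simp add: power2_eq_square)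
      then show ?thesis using sc by simp
    qed
    have e2: "k * (1 + cos \<theta>) = - sin \<theta>"
    proof -
      have "1 + cos \<theta> = 2 * c\<^sup>2" using sc by simp
      then show ?thesis unfolding sc(3) using sc(2,5) by (simp add: power2_eq_square)
    qed
    let ?S = "\<lambda>z::real\<times>real. (fst z + k * snd z, snd z)"
    let ?T = "\<lambda>z::real\<times>real. (fst z, snd z + sin \<theta> * fst z)"
    have "rot \<theta> = (\<lambda>z. ?S (?T (?S z)))"
    proof
      fix z :: "real \<times> real"
      obtain a b where z: "z = (a, b)" by force
      have "a * cos \<theta> - b * sin \<theta> = a * (1 + k * sin \<theta>) + b * (k * (1 + (1 + k * sin \<theta>)))"
        unfolding e1 e2 by simp
      moreover have "a * sin \<theta> + b * cos \<theta> = a * sin \<theta> + b * (1 + k * sin \<theta>)"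
        unfolding e1 ..
      ultimately show "rot \<theta> z = ?S (?T (?S z))"
        by (simp add: rot_def z algebra_simps)
    qed
    moreover have "distr lborel borel (\<lambda>z. ?S (?T (?S z))) = lborel"
      by (intro lborel_distr_compose[of ?S "\<lambda>z. ?T (?S z)"] lborel_distr_compose[of ?T ?S]
          lborel_distr_shear_fst lborel_distr_shear_snd borel_measurable_continuous_onI continuous_intros)
    ultimately show ?thesis by simp
  qed
  show ?thesis
  proof (cases "cos (\<theta> / 2) = 0")
    case True
    then have "cos (\<theta> / 4) \<noteq> 0"
      using cos_double_cos[of "\<theta> / 4"] by auto
    then have "distr lborel borel (rot (\<theta> / 2)) = lborel" by (intro shears) simp
    then have "distr lborel borel (\<lambda>z. rot (\<theta> / 2) (rot (\<theta> / 2) z)) = lborel"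
      using lborel_distr_compose[of "rot (\<theta> / 2)" "rot (\<theta> / 2)"] by simp
    then show ?thesis by (simp add: rot_rot)
  qed (rule shears)
qed

lemma lborel_distr_rigid: "distr lborel borel (\<lambda>z. x + rot \<theta> z) = lborel"
  by (rule lborel_distr_compose[of "(+) x" "rot \<theta>"]) (simp_all only: lborel_distr_plus lborel_distr_rot, measurable)

lemma
  fixes g :: "real \<times> real \<Rightarrow> 'b::{banach, second_countable_topology}"
  assumes [measurable]: "g \<in> borel_measurable borel"
  shows integral_rigid: "(LINT z|lborel. g (x + rot \<theta> z)) = (LINT z|lborel. g z)"
    and integrable_rigid: "integrable lborel (\<lambda>z. g (x + rot \<theta> z)) \<longleftrightarrow> integrable lborel g"
proof -
  have [measurable]: "(\<lambda>z. x + rot \<theta> z) \<in> lborel \<rightarrow>\<^sub>M borel" by measurable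
  show "(LINT z|lborel. g (x + rot \<theta> z)) = (LINT z|lborel. g z)"
    using integral_distr[of "\<lambda>z. x + rot \<theta> z" lborel borel g] by (simp add: lborel_distr_rigid)
  show "integrable lborel (\<lambda>z. g (x + rot \<theta> z)) \<longleftrightarrow> integrable lborel g"
    using integrable_distr_eq[of "\<lambda>z. x + rot \<theta> z" lborel borel g] by (simp add: lborel_distr_rigid)
qed

section \<open>The Poisson kernel\<close>

lemma FTC_line_nonneg:
  fixes f F :: "real \<Rightarrow> real"
  assumes "\<And>x. DERIV F x :> f x" "\<And>x. isCont f x" "\<And>x. 0 \<le> f x"
    and "(F \<longlongrightarrow> A) at_bot" "(F \<longlongrightarrow> B) at_top"
  shows "has_bochner_integral lborel f (B - A)"
proof -
  have "((F \<circ> real_of_ereal) \<longlongrightarrow> A) (at_right (-\<infinity>))" "((F \<circ> real_of_ereal) \<longlongrightarrow> B) (at_left \<infinity>)"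
    using assms(4,5) by (simp_all add: ereal_tendsto_simps)
  note * = interval_integral_FTC_nonneg[of "-\<infinity>" \<infinity> F f, OF _ assms(1) assms(2) _ this]
  show ?thesis
    using * assms(3)
    by (auto simp: has_bochner_integral_iff set_integrable_def interval_lebesgue_integral_def set_lebesgue_integral_def einterval_def)
qed

text \<open>The Poisson kernel of the half space above the plane, at height \<open>\<alpha>\<close>.\<close>

definition poisson_kernel :: "real \<Rightarrow> real \<times> real \<Rightarrow> real" where
  "poisson_kernel \<alpha> z = \<alpha> / (2 * pi * sqrt (\<alpha>\<^sup>2 + (norm z)\<^sup>2) ^ 3)"

lemma poisson_kernel_measurable [measurable]: "poisson_kernel \<alpha> \<in> borel_measurable borel"
  unfolding poisson_kernel_def by measurable

lemma has_bochner_integral_inverse_sqrt_cubed: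
  assumes "a > 0"
  shows "has_bochner_integral lborel (\<lambda>y::real. 1 / sqrt (a + y\<^sup>2) ^ 3) (2 / a)"
proof -
  have pos: "a + y\<^sup>2 > 0" for y using assms by (simp add: add_pos_nonneg)
  have "has_bochner_integral lborel (\<lambda>y::real. 1 / sqrt (a + y\<^sup>2) ^ 3) (inverse a - (- inverse a))"
  proof (rule FTC_line_nonneg)
    fix y :: real
    have w: "sqrt (a + y\<^sup>2) > 0" "(sqrt (a + y\<^sup>2))\<^sup>2 = a + y\<^sup>2" "sqrt (a + y\<^sup>2) \<noteq> 0" using pos[of y] by auto
    show "DERIV (\<lambda>y. y / (a * sqrt (a + y\<^sup>2))) y :> 1 / sqrt (a + y\<^sup>2) ^ 3"
    proof -
      have "DERIV (\<lambda>y. y / (a * sqrt (a + y\<^sup>2))) y :>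
         (1 * (a * sqrt (a + y\<^sup>2)) - y * (a * (inverse (sqrt (a + y\<^sup>2)) / 2 * (2 * y)))) / ((a * sqrt (a + y\<^sup>2)) * (a * sqrt (a + y\<^sup>2)))"
        using assms pos[of y] w by (auto intro!: derivative_eq_intros simp: divide_simps)
      also have "(1 * (a * sqrt (a + y\<^sup>2)) - y * (a * (inverse (sqrt (a + y\<^sup>2)) / 2 * (2 * y)))) / ((a * sqrt (a + y\<^sup>2)) * (a * sqrt (a + y\<^sup>2))) = 1 / sqrt (a + y\<^sup>2) ^ 3"
      proof -
        define v where "v = sqrt (a + y\<^sup>2)"
        have v: "v > 0" "a = v\<^sup>2 - y\<^sup>2" using w by (auto simp: v_def)
        have "(1 * (a * v) - y * (a * (inverse v / 2 * (2 * y)))) = a * (v\<^sup>2 - y\<^sup>2) / v"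
          using v(1) by (simp add: field_simps power2_eq_square)
        also have "\<dots> / ((a * v) * (a * v)) = 1 / v ^ 3"
          using v(1) assms unfolding v(2)[symmetric] by (simp add: field_simps power2_eq_square power3_eq_cube)
        finally show ?thesis unfolding v_def .
      qed
      finally show ?thesis .
    qed
    show "isCont (\<lambda>y. 1 / sqrt (a + y\<^sup>2) ^ 3) y"
      using w by (intro continuous_intros) auto
    show "0 \<le> 1 / sqrt (a + y\<^sup>2) ^ 3" using w by simp
  next
    show "((\<lambda>y. y / (a * sqrt (a + y\<^sup>2))) \<longlongrightarrow> - inverse a) at_bot"
      using assms by real_asymp
    show "((\<lambda>y. y / (a * sqrt (a + y\<^sup>2))) \<longlongrightarrow> inverse a) at_top"
      using assms by real_asymp
  qed
  then show ?thesis by (simp add: divide_inverse)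
qed

text \<open>
  The total mass is computed one coordinate at a time: integrating over the second coordinate leaves
  the one-dimensional Cauchy density \<open>\<alpha> / (pi * (\<alpha>\<^sup>2 + a\<^sup>2))\<close>, whose mass is 1.
\<close>

lemma has_bochner_integral_poisson_kernel:
  assumes "\<alpha> > 0"
  shows "has_bochner_integral lborel (poisson_kernel \<alpha>) 1"
proof -
  have K: "poisson_kernel \<alpha> (a, b) = \<alpha> / (2 * pi) * (1 / sqrt ((\<alpha>\<^sup>2 + a\<^sup>2) + b\<^sup>2) ^ 3)" for a b
    by (simp add: poisson_kernel_def norm_prod_def add.assoc)
  have inner: "has_bochner_integral lborel (\<lambda>b. poisson_kernel \<alpha> (a, b)) (\<alpha> / (pi * (\<alpha>\<^sup>2 + a\<^sup>2)))" for a
  proof -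
    have "has_bochner_integral lborel (\<lambda>b. \<alpha> / (2 * pi) * (1 / sqrt ((\<alpha>\<^sup>2 + a\<^sup>2) + b\<^sup>2) ^ 3)) (\<alpha> / (2 * pi) * (2 / (\<alpha>\<^sup>2 + a\<^sup>2)))"
      using assms by (intro has_bochner_integral_mult_right has_bochner_integral_inverse_sqrt_cubed) (simp add: add_pos_nonneg)
    then show ?thesis by (simp add: K)
  qed
  have outer: "has_bochner_integral lborel (\<lambda>a. \<alpha> / (pi * (\<alpha>\<^sup>2 + a\<^sup>2))) (1 / 2 - (- 1 / 2))"
  proof (rule FTC_line_nonneg)
    fix a :: real
    have p: "\<alpha>\<^sup>2 + a\<^sup>2 > 0" using assms by (simp add: add_pos_nonneg)
    show "DERIV (\<lambda>a. arctan (a / \<alpha>) / pi) a :> \<alpha> / (pi * (\<alpha>\<^sup>2 + a\<^sup>2))"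
    proof -
      have "DERIV (\<lambda>a. arctan (a / \<alpha>) / pi) a :> inverse (1 + (a / \<alpha>)\<^sup>2) * (1 / \<alpha>) / pi"
        using assms by (auto intro!: derivative_eq_intros)
      also have "inverse (1 + (a / \<alpha>)\<^sup>2) * (1 / \<alpha>) / pi = \<alpha> / (pi * (\<alpha>\<^sup>2 + a\<^sup>2))"
      proof -
        have "1 + (a / \<alpha>)\<^sup>2 = (\<alpha>\<^sup>2 + a\<^sup>2) / \<alpha>\<^sup>2" using assms by (simp add: field_simps)
        then show ?thesis using assms p by (simp add: power2_eq_square)
      qed
      finally show ?thesis .
    qed
    show "isCont (\<lambda>a. \<alpha> / (pi * (\<alpha>\<^sup>2 + a\<^sup>2))) a" using p by (intro continuous_intros) auto
    show "0 \<le> \<alpha> / (pi * (\<alpha>\<^sup>2 + a\<^sup>2))" using p assms by simp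
  next
    show "((\<lambda>a. arctan (a / \<alpha>) / pi) \<longlongrightarrow> - 1 / 2) at_bot"
      using assms by real_asymp
    show "((\<lambda>a. arctan (a / \<alpha>) / pi) \<longlongrightarrow> 1 / 2) at_top"
      using assms by real_asymp
  qed
  have nonneg: "norm (poisson_kernel \<alpha> z) = poisson_kernel \<alpha> z" for z
    using assms by (simp add: poisson_kernel_def)
  have int: "integrable (lborel \<Otimes>\<^sub>M lborel) (poisson_kernel \<alpha>)"
  proof (rule lborel_pair.Fubini_integrable)
    show "poisson_kernel \<alpha> \<in> borel_measurable (lborel \<Otimes>\<^sub>M lborel)"
      by (simp add: lborel_prod)
    show "integrable lborel (\<lambda>x. LINT y|lborel. norm (poisson_kernel \<alpha> (x, y)))"
      using outer inner unfolding nonneg by (simp add: has_bochner_integral_iff)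
    show "AE x in lborel. integrable lborel (\<lambda>y. poisson_kernel \<alpha> (x, y))"
      using inner by (simp add: has_bochner_integral_iff)
  qed
  moreover have "integral\<^sup>L (lborel \<Otimes>\<^sub>M lborel) (poisson_kernel \<alpha>) = 1"
    using outer inner by (simp add: lborel_pair.integral_fst'[OF int, symmetric] has_bochner_integral_iff)
  ultimately show ?thesis by (simp add: has_bochner_integral_iff lborel_prod)
qed

lemma poisson_kernel_bounds:
  assumes "\<alpha> > 0"
  shows "0 \<le> poisson_kernel \<alpha> z" "poisson_kernel \<alpha> z \<le> 1 / (2 * pi * \<alpha>\<^sup>2)"
proof -
  show "0 \<le> poisson_kernel \<alpha> z" using assms by (simp add: poisson_kernel_def)
  have "\<alpha> \<le> sqrt (\<alpha>\<^sup>2 + (norm z)\<^sup>2)" using assms by (intro real_le_rsqrt) simp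
  then have "\<alpha> ^ 3 \<le> sqrt (\<alpha>\<^sup>2 + (norm z)\<^sup>2) ^ 3" using assms by (intro power_mono) auto
  moreover have "\<alpha>\<^sup>2 + (norm z)\<^sup>2 > 0" using assms by (simp add: add_pos_nonneg)
  ultimately have "poisson_kernel \<alpha> z \<le> \<alpha> / (2 * pi * \<alpha> ^ 3)"
    unfolding poisson_kernel_def using assms by (intro divide_left_mono mult_left_mono mult_pos_pos) auto
  also have "\<dots> = 1 / (2 * pi * \<alpha>\<^sup>2)" using assms by (simp add: power2_eq_square power3_eq_cube)
  finally show "poisson_kernel \<alpha> z \<le> 1 / (2 * pi * \<alpha>\<^sup>2)" .
qed

lemma abs_poisson_kernel_le:
  assumes "\<alpha> > 0" shows "\<bar>poisson_kernel \<alpha> z\<bar> \<le> \<bar>1 / (2 * pi * \<alpha>\<^sup>2)\<bar>"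
  using poisson_kernel_bounds[OF assms, of z] by simp

text \<open>
  Away from the origin the kernel is of order \<open>\<alpha>\<close>, uniformly relative to the fixed integrable
  kernel at height 1. This bounds the contribution of distant points to the Poisson integral of a
  function that is merely integrable, as well as to that of a constant.
\<close>

lemma poisson_kernel_away_from_0:
  assumes "\<delta> > 0" "\<delta> \<le> norm z" "\<alpha> > 0"
  shows "poisson_kernel \<alpha> z \<le> \<alpha> * (sqrt (1 / \<delta>\<^sup>2 + 1) ^ 3 * poisson_kernel 1 z)"
proof -
  define \<rho> where "\<rho> = norm z"
  have \<rho>: "\<rho> > 0" "\<delta> \<le> \<rho>" using assms by (auto simp: \<rho>_def)
  define C where "C = sqrt (1 / \<delta>\<^sup>2 + 1)"
  define s where "s = sqrt (1 + \<rho>\<^sup>2)"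
  have s: "s > 0" unfolding s_def by (simp add: add_pos_nonneg)
  have "1 \<le> \<rho>\<^sup>2 / \<delta>\<^sup>2" using \<rho> assms(1) by (simp add: power_mono)
  then have "1 + \<rho>\<^sup>2 \<le> (1 / \<delta>\<^sup>2 + 1) * \<rho>\<^sup>2" by (simp add: distrib_right)
  then have "s \<le> C * \<rho>" unfolding s_def C_def using \<rho>(1)
    by (metis real_sqrt_le_mono real_sqrt_mult real_sqrt_abs abs_of_pos)
  then have sC: "s ^ 3 \<le> C ^ 3 * \<rho> ^ 3" using s power_mono[of s "C * \<rho>" 3] by (simp add: power_mult_distrib)
  have "\<rho> \<le> sqrt (\<alpha>\<^sup>2 + \<rho>\<^sup>2)" by (intro real_le_rsqrt) simp
  then have "\<rho> ^ 3 \<le> sqrt (\<alpha>\<^sup>2 + \<rho>\<^sup>2) ^ 3" using \<rho> by (intro power_mono) auto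
  then have "poisson_kernel \<alpha> z \<le> \<alpha> / (2 * pi * \<rho> ^ 3)"
    unfolding poisson_kernel_def \<rho>_def[symmetric] using assms(3) \<rho> by (intro divide_left_mono mult_left_mono mult_pos_pos) (auto simp: add_pos_pos)
  also have "\<dots> \<le> \<alpha> * (C ^ 3 / (2 * pi * s ^ 3))"
    using sC \<rho>(1) s assms(3) by (simp add: field_simps)
  finally show ?thesis by (simp add: poisson_kernel_def C_def s_def \<rho>_def)
qed

text \<open>
  Since the kernel has mass 1, the error is the integral of the kernel against \<open>h - L\<close>. Close to the
  origin \<open>h - L\<close> is small; elsewhere \<open>h\<close> may be unbounded, but there the kernel is at most a constant
  times \<open>\<alpha>\<close> times the kernel at height 1, against which \<open>h - L\<close> is integrable.
\<close>

lemma poisson_kernel_approximate_identity: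
  fixes h :: "real \<times> real \<Rightarrow> complex"
  assumes h: "integrable lborel h" and lim: "(h \<longlongrightarrow> L) (at 0)"
  shows "((\<lambda>\<alpha>. LINT z|lborel. complex_of_real (poisson_kernel \<alpha> z) * h z) \<longlongrightarrow> L) (at_right 0)"
proof (rule tendstoI)
  fix e :: real assume e: "e > 0"
  have [measurable]: "h \<in> borel_measurable borel" using h by (simp add: borel_measurable_integrable)
  obtain \<delta> where \<delta>: "\<delta> > 0" "\<And>z. z \<noteq> 0 \<Longrightarrow> norm z < \<delta> \<Longrightarrow> dist (h z) L < e / 2"
    using tendstoD[OF lim, of "e / 2"] e unfolding eventually_at by (auto simp: dist_norm)
  define C where "C = sqrt (1 / \<delta>\<^sup>2 + 1) ^ 3"
  have intK: "integrable lborel (poisson_kernel \<alpha>)" "(LINT z|lborel. poisson_kernel \<alpha> z) = 1" if "\<alpha> > 0" for \<alpha>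
    using has_bochner_integral_poisson_kernel[OF that] by (auto simp: has_bochner_integral_iff)
  have intKh: "integrable lborel (\<lambda>z. complex_of_real (poisson_kernel \<alpha> z) * h z)" if "\<alpha> > 0" for \<alpha>
  proof (rule Bochner_Integration.integrable_bound)
    show "integrable lborel (\<lambda>y. complex_of_real (1 / (2 * pi * \<alpha>\<^sup>2)) * h y)" using h by simp
    show "AE y in lborel. norm (complex_of_real (poisson_kernel \<alpha> y) * h y) \<le> norm (complex_of_real (1 / (2 * pi * \<alpha>\<^sup>2)) * h y)"
      unfolding norm_mult norm_of_real
      by (intro AE_I2 mult_right_mono norm_ge_zero abs_poisson_kernel_le that)
  qed measurable
  have intKd: "integrable lborel (\<lambda>z. complex_of_real (poisson_kernel \<alpha> z) * (h z - L))" if "\<alpha> > 0" for \<alpha>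
    using intKh[OF that] intK(1)[OF that] by (simp add: right_diff_distrib)
  define J where "J = (LINT z|lborel. poisson_kernel 1 z * norm (h z - L))"
  have intJ: "integrable lborel (\<lambda>z. poisson_kernel 1 z * norm (h z - L))"
    using integrable_norm[OF intKd[of 1]] poisson_kernel_bounds(1)[of 1] by (simp add: norm_mult)
  have bound: "norm ((LINT z|lborel. complex_of_real (poisson_kernel \<alpha> z) * h z) - L) \<le> e / 2 + \<alpha> * (C * J)"
    if \<alpha>: "\<alpha> > 0" for \<alpha>
  proof -
    note K = intK[OF \<alpha>]
    have "(LINT z|lborel. complex_of_real (poisson_kernel \<alpha> z) * h z) - L
       = (LINT z|lborel. complex_of_real (poisson_kernel \<alpha> z) * h z) - (LINT z|lborel. complex_of_real (poisson_kernel \<alpha> z) * L)"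
      using K by simp
    also have "\<dots> = (LINT z|lborel. complex_of_real (poisson_kernel \<alpha> z) * (h z - L))"
      using intKh[OF \<alpha>] K(1) by (simp add: right_diff_distrib)
    also have "norm \<dots> \<le> (LINT z|lborel. norm (complex_of_real (poisson_kernel \<alpha> z) * (h z - L)))"
      by (rule integral_norm_bound)
    also have "\<dots> \<le> (LINT z|lborel. e / 2 * poisson_kernel \<alpha> z + \<alpha> * (C * (poisson_kernel 1 z * norm (h z - L))))"
    proof (rule integral_mono_AE)
      show "integrable lborel (\<lambda>z. norm (complex_of_real (poisson_kernel \<alpha> z) * (h z - L)))"
        by (intro integrable_norm intKd \<alpha>)
      show "integrable lborel (\<lambda>z. e / 2 * poisson_kernel \<alpha> z + \<alpha> * (C * (poisson_kernel 1 z * norm (h z - L))))"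
        using K(1) intJ by simp
      have "norm (complex_of_real (poisson_kernel \<alpha> z) * (h z - L))
          \<le> e / 2 * poisson_kernel \<alpha> z + \<alpha> * (C * (poisson_kernel 1 z * norm (h z - L)))" if "z \<noteq> 0" for z
      proof -
        have eq: "norm (complex_of_real (poisson_kernel \<alpha> z) * (h z - L)) = poisson_kernel \<alpha> z * norm (h z - L)"
          using poisson_kernel_bounds(1)[OF \<alpha>, of z] by (simp add: norm_mult)
        have C: "C \<ge> 0" by (simp add: C_def)
        have n1: "0 \<le> \<alpha> * (C * (poisson_kernel 1 z * norm (h z - L)))"
          using \<alpha> C poisson_kernel_bounds(1)[of 1 z] by simp
        have n2: "0 \<le> e / 2 * poisson_kernel \<alpha> z"
          using e poisson_kernel_bounds(1)[OF \<alpha>, of z] by simp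
        show ?thesis
        proof (cases "norm z < \<delta>")
          case True
          then have "norm (h z - L) \<le> e / 2" using \<delta>(2)[OF that] by (simp add: dist_norm)
          then have "poisson_kernel \<alpha> z * norm (h z - L) \<le> poisson_kernel \<alpha> z * (e / 2)"
            by (rule mult_left_mono) (rule poisson_kernel_bounds(1)[OF \<alpha>])
          then show ?thesis using n1 unfolding eq by (simp add: mult.commute)
        next
          case False
          then have "poisson_kernel \<alpha> z * norm (h z - L) \<le> \<alpha> * (C * poisson_kernel 1 z) * norm (h z - L)"
            unfolding C_def using \<delta>(1) \<alpha> by (intro mult_right_mono poisson_kernel_away_from_0) auto
          then show ?thesis using n2 unfolding eq by (simp add: mult.assoc)
        qed
      qed
      then show "AE z in lborel. norm (complex_of_real (poisson_kernel \<alpha> z) * (h z - L))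
          \<le> e / 2 * poisson_kernel \<alpha> z + \<alpha> * (C * (poisson_kernel 1 z * norm (h z - L)))"
        using AE_lborel_singleton[of "0::real\<times>real"] by (auto elim: eventually_mono)
    qed
    also have "\<dots> = e / 2 + \<alpha> * (C * J)"
      using K intJ by (simp add: J_def)
    finally show ?thesis .
  qed
  have "((\<lambda>\<alpha>. e / 2 + \<alpha> * (C * J)) \<longlongrightarrow> e / 2 + 0 * (C * J)) (at_right 0)"
    by (intro tendsto_intros)
  then have "\<forall>\<^sub>F \<alpha> in at_right 0. e / 2 + \<alpha> * (C * J) < e"
    by (rule order_tendstoD(2)) (use e in simp)
  moreover have "\<forall>\<^sub>F \<alpha>::real in at_right 0. \<alpha> > 0"
    by (simp add: eventually_at_right_less)
  ultimately show "\<forall>\<^sub>F \<alpha> in at_right 0. dist (LINT z|lborel. complex_of_real (poisson_kernel \<alpha> z) * h z) L < e"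
    by eventually_elim (use bound in \<open>force simp: dist_norm\<close>)
qed

section \<open>Superposition of plane waves\<close>

text \<open>
  On an interval of length \<open>pi\<close> about zero with \<open>p = cos\<close>, the substitution \<open>t = tan \<psi>\<close> yields the
  primitive \<open>arctan (\<alpha> * t / w)\<close> up to a factor and a rational term, but it breaks down where the
  tangent has a pole. Subtracting \<open>\<psi>\<close> from this arctangent and applying the addition formula gives
  the arctangent below, whose denominator never vanishes; thus one primitive serves on the whole
  line and for every phase of \<open>p\<close>. Everything but the summand \<open>\<psi>\<close> has period \<open>pi\<close>, so that only
  \<open>\<alpha> / w ^ 3 * pi\<close> survives over a full period. The verification uses only \<open>p' = q\<close>, \<open>q' = - p\<close>
  and \<open>p\<^sup>2 + q\<^sup>2 = w\<^sup>2 - \<alpha>\<^sup>2\<close>.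
\<close>

lemma angular_primitive_deriv:
  fixes \<alpha> a b :: real
  assumes \<alpha>: "\<alpha> > 0" and ab: "a \<noteq> 0 \<or> b \<noteq> 0"
  defines "w \<equiv> sqrt (\<alpha>\<^sup>2 + (a\<^sup>2 + b\<^sup>2))"
  defines "p \<equiv> \<lambda>\<psi>. a * cos \<psi> + b * sin \<psi>" and "q \<equiv> \<lambda>\<psi>. b * cos \<psi> - a * sin \<psi>"
  shows "((\<lambda>\<psi>. \<alpha> / w ^ 3 * (\<psi> + arctan ((w - \<alpha>) * (p \<psi> * q \<psi>) / (w * (p \<psi>)\<^sup>2 + \<alpha> * (q \<psi>)\<^sup>2)))
            + 1 / w\<^sup>2 * (p \<psi> * q \<psi> / (\<alpha>\<^sup>2 + (p \<psi>)\<^sup>2)))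
         has_real_derivative ((\<alpha>\<^sup>2 - (p \<psi>)\<^sup>2) / (\<alpha>\<^sup>2 + (p \<psi>)\<^sup>2)\<^sup>2)) (at \<psi>)"
proof -
  have p': "(p has_real_derivative q \<psi>) (at \<psi>)" for \<psi>
    unfolding p_def q_def by (auto intro!: derivative_eq_intros)
  have q': "(q has_real_derivative - p \<psi>) (at \<psi>)" for \<psi>
    unfolding p_def q_def by (auto intro!: derivative_eq_intros)
  have pos: "a\<^sup>2 + b\<^sup>2 > 0" using ab by (simp add: sum_power2_gt_zero_iff)
  have w2: "w\<^sup>2 = \<alpha>\<^sup>2 + (a\<^sup>2 + b\<^sup>2)" unfolding w_def using pos by simp
  have "w > \<alpha>" using \<alpha> pos unfolding w_def by (intro real_less_rsqrt) simp
  then have w: "w > 0" "w - \<alpha> > 0" "w + \<alpha> > 0" using \<alpha> by auto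
  define P Q where "P = p \<psi>" and "Q = q \<psi>"
  have "P\<^sup>2 + Q\<^sup>2 = (a\<^sup>2 + b\<^sup>2) * ((cos \<psi>)\<^sup>2 + (sin \<psi>)\<^sup>2)"
    unfolding P_def Q_def p_def q_def by (simp only: power2_eq_square) (simp only: algebra_simps)
  then have PQ: "Q\<^sup>2 = w\<^sup>2 - \<alpha>\<^sup>2 - P\<^sup>2" "P\<^sup>2 + Q\<^sup>2 = w\<^sup>2 - \<alpha>\<^sup>2" "P\<^sup>2 + Q\<^sup>2 > 0"
    using w2 pos by (auto simp: add.commute)
  define M N where "M = w * P\<^sup>2 + \<alpha> * Q\<^sup>2" and "N = (w - \<alpha>) * (P * Q)"
  have "\<alpha> * (P\<^sup>2 + Q\<^sup>2) \<le> M"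
    unfolding M_def using w by (simp add: distrib_left mult_right_mono)
  moreover have "0 < \<alpha> * (P\<^sup>2 + Q\<^sup>2)" using \<alpha> PQ(3) by simp
  ultimately have M: "M > 0" by linarith
  define E where "E = \<alpha>\<^sup>2 + P\<^sup>2"
  have E: "E > 0" using \<alpha> by (simp add: E_def add_pos_nonneg)
  have MN: "M\<^sup>2 + N\<^sup>2 = ((w - \<alpha>) * (w + \<alpha>)) * E * (P\<^sup>2 + Q\<^sup>2)"
  proof -
    have "M\<^sup>2 + N\<^sup>2 = (w\<^sup>2 * P\<^sup>2 + \<alpha>\<^sup>2 * Q\<^sup>2) * (P\<^sup>2 + Q\<^sup>2)"
      unfolding M_def N_def by algebra
    moreover have "w\<^sup>2 * P\<^sup>2 + \<alpha>\<^sup>2 * Q\<^sup>2 = ((w - \<alpha>) * (w + \<alpha>)) * E"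
      unfolding PQ(1) E_def by algebra
    ultimately show ?thesis by simp
  qed
  have num: "((w - \<alpha>) * (Q\<^sup>2 - P\<^sup>2)) * M - N * (2 * (w - \<alpha>) * (P * Q)) = (w - \<alpha>) * (\<alpha> * Q\<^sup>2 - w * P\<^sup>2) * (P\<^sup>2 + Q\<^sup>2)"
    unfolding M_def N_def by algebra
  have at: "((\<lambda>\<psi>. arctan ((w - \<alpha>) * (p \<psi> * q \<psi>) / (w * (p \<psi>)\<^sup>2 + \<alpha> * (q \<psi>)\<^sup>2))) has_real_derivative
      (\<alpha> * w / E - 1)) (at \<psi>)"
  proof -
    have "((\<lambda>\<psi>. arctan ((w - \<alpha>) * (p \<psi> * q \<psi>) / (w * (p \<psi>)\<^sup>2 + \<alpha> * (q \<psi>)\<^sup>2))) has_real_derivative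
      inverse (1 + (N / M)\<^sup>2) * ((((w - \<alpha>) * (Q\<^sup>2 - P\<^sup>2)) * M - N * (2 * (w - \<alpha>) * (P * Q))) / (M * M))) (at \<psi>)"
      using M unfolding P_def Q_def M_def N_def
      by (auto intro!: derivative_eq_intros p' q' simp: power2_eq_square algebra_simps)
    also have "inverse (1 + (N / M)\<^sup>2) = M\<^sup>2 / (M\<^sup>2 + N\<^sup>2)"
    proof -
      have "1 + (N / M)\<^sup>2 = (M\<^sup>2 + N\<^sup>2) / M\<^sup>2" using M by (simp add: field_simps)
      then show ?thesis by simp
    qed
    also have "M\<^sup>2 / (M\<^sup>2 + N\<^sup>2) * ((((w - \<alpha>) * (Q\<^sup>2 - P\<^sup>2)) * M - N * (2 * (w - \<alpha>) * (P * Q))) / (M * M))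
        = (\<alpha> * Q\<^sup>2 - w * P\<^sup>2) / ((w + \<alpha>) * E)"
      unfolding num MN using M w E PQ(3) by (simp add: power2_eq_square)
    also have "(\<alpha> * Q\<^sup>2 - w * P\<^sup>2) / ((w + \<alpha>) * E) = \<alpha> * w / E - 1"
    proof -
      have "\<alpha> * Q\<^sup>2 - w * P\<^sup>2 = \<alpha> * w * (w + \<alpha>) - (w + \<alpha>) * E"
        unfolding PQ(1) E_def by algebra
      then show ?thesis using w E by (simp add: diff_divide_distrib)
    qed
    finally show ?thesis .
  qed
  have rat: "((\<lambda>\<psi>. p \<psi> * q \<psi> / (\<alpha>\<^sup>2 + (p \<psi>)\<^sup>2)) has_real_derivative
      (((Q\<^sup>2 - P\<^sup>2) * E - P * Q * (2 * P * Q)) / (E * E))) (at \<psi>)"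
    using E unfolding P_def Q_def E_def
    by (auto intro!: derivative_eq_intros p' q' simp: power2_eq_square algebra_simps)
  have "(Q\<^sup>2 - P\<^sup>2) * E - P * Q * (2 * P * Q) = w\<^sup>2 * (\<alpha>\<^sup>2 - P\<^sup>2) - \<alpha>\<^sup>2 * E"
  proof -
    have "(Q\<^sup>2 - P\<^sup>2) * E - P * Q * (2 * P * Q) = (Q\<^sup>2 - P\<^sup>2) * E - 2 * P\<^sup>2 * Q\<^sup>2" by algebra
    then show ?thesis unfolding PQ(1) E_def by algebra
  qed
  note rat = rat[unfolded this]
  have "((\<lambda>\<psi>. \<alpha> / w ^ 3 * (\<psi> + arctan ((w - \<alpha>) * (p \<psi> * q \<psi>) / (w * (p \<psi>)\<^sup>2 + \<alpha> * (q \<psi>)\<^sup>2)))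
            + 1 / w\<^sup>2 * (p \<psi> * q \<psi> / (\<alpha>\<^sup>2 + (p \<psi>)\<^sup>2)))
         has_real_derivative (\<alpha> / w ^ 3 * (1 + (\<alpha> * w / E - 1)) + 1 / w\<^sup>2 * ((w\<^sup>2 * (\<alpha>\<^sup>2 - P\<^sup>2) - \<alpha>\<^sup>2 * E) / (E * E)))) (at \<psi>)"
    by (intro DERIV_add DERIV_cmult at rat DERIV_ident)
  also have "\<alpha> / w ^ 3 * (1 + (\<alpha> * w / E - 1)) + 1 / w\<^sup>2 * ((w\<^sup>2 * (\<alpha>\<^sup>2 - P\<^sup>2) - \<alpha>\<^sup>2 * E) / (E * E))
     = (\<alpha>\<^sup>2 - P\<^sup>2) / E\<^sup>2"
    using w E by (simp add: field_simps power2_eq_square power3_eq_cube)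
  finally show ?thesis unfolding P_def E_def .
qed

lemma angular_integral:
  fixes \<alpha> a b :: real
  assumes \<alpha>: "\<alpha> > 0"
  shows "(LINT \<psi>:{0..<pi}|lborel. (\<alpha>\<^sup>2 - (a * cos \<psi> + b * sin \<psi>)\<^sup>2) / (\<alpha>\<^sup>2 + (a * cos \<psi> + b * sin \<psi>)\<^sup>2)\<^sup>2)
     = pi * \<alpha> / sqrt (\<alpha>\<^sup>2 + (a\<^sup>2 + b\<^sup>2)) ^ 3"
proof -
  define w where "w = sqrt (\<alpha>\<^sup>2 + (a\<^sup>2 + b\<^sup>2))"
  define p where "p = (\<lambda>\<psi>. a * cos \<psi> + b * sin \<psi>)"
  define q where "q = (\<lambda>\<psi>. b * cos \<psi> - a * sin \<psi>)"
  define f where "f = (\<lambda>\<psi>. (\<alpha>\<^sup>2 - (p \<psi>)\<^sup>2) / (\<alpha>\<^sup>2 + (p \<psi>)\<^sup>2)\<^sup>2)"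
  have nz: "\<alpha>\<^sup>2 + y\<^sup>2 \<noteq> 0" for y :: real using \<alpha> by (simp add: sum_power2_eq_zero_iff)
  have cont: "continuous_on UNIV f" unfolding f_def p_def
    using nz by (intro continuous_intros) auto
  have "\<exists>G. (\<forall>\<psi>. (G has_real_derivative f \<psi>) (at \<psi>)) \<and> G pi - G 0 = pi * \<alpha> / w ^ 3"
  proof (cases "a \<noteq> 0 \<or> b \<noteq> 0")
    case True
    let ?G = "\<lambda>\<psi>. \<alpha> / w ^ 3 * (\<psi> + arctan ((w - \<alpha>) * (p \<psi> * q \<psi>) / (w * (p \<psi>)\<^sup>2 + \<alpha> * (q \<psi>)\<^sup>2)))
            + 1 / w\<^sup>2 * (p \<psi> * q \<psi> / (\<alpha>\<^sup>2 + (p \<psi>)\<^sup>2))"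
    have "\<forall>\<psi>. (?G has_real_derivative f \<psi>) (at \<psi>)"
      using angular_primitive_deriv[OF \<alpha> True] unfolding f_def p_def q_def w_def by blast
    moreover have "?G pi - ?G 0 = pi * \<alpha> / w ^ 3"
    proof -
      have "p pi = - p 0" "q pi = - q 0" by (simp_all add: p_def q_def)
      then show ?thesis by (simp add: distrib_left mult.commute)
    qed
    ultimately show ?thesis by (intro exI[of _ ?G]) blast
  next
    \<comment> \<open>For \<open>a = b = 0\<close> the argument of the arctangent above degenerates, but the integrand is constant.\<close>
    case False
    then have "f = (\<lambda>_. 1 / \<alpha>\<^sup>2)" "w = \<alpha>"
      using \<alpha> by (auto simp: f_def p_def w_def power2_eq_square)
    then show ?thesis using \<alpha>
      by (intro exI[of _ "\<lambda>\<psi>. \<psi> / \<alpha>\<^sup>2"]) (auto intro!: derivative_eq_intros simp: power2_eq_square power3_eq_cube)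
  qed
  then obtain G where G: "\<And>\<psi>. (G has_real_derivative f \<psi>) (at \<psi>)" "G pi - G 0 = pi * \<alpha> / w ^ 3" by blast
  have [measurable]: "f \<in> borel_measurable borel" using cont by (rule borel_measurable_continuous_onI)
  have "(LINT \<psi>:{0..<pi}|lborel. f \<psi>) = (LINT \<psi>|lborel. indicator {0..pi} \<psi> *\<^sub>R f \<psi>)"
    unfolding set_lebesgue_integral_def
  proof (rule integral_cong_AE)
    show "AE \<psi> in lborel. indicator {0..<pi} \<psi> *\<^sub>R f \<psi> = indicator {0..pi} \<psi> *\<^sub>R f \<psi>"
      using AE_lborel_singleton[of pi] by eventually_elim (auto simp: indicator_def)
  qed measurable
  also have "\<dots> = G pi - G 0"
  proof (rule integral_FTC_atLeastAtMost)
    show "(G has_vector_derivative f \<psi>) (at \<psi> within {0..pi})" for \<psi>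
      using G(1)[of \<psi>] by (meson has_real_derivative_iff_has_vector_derivative has_vector_derivative_at_within)
  qed (use continuous_on_subset[OF cont] in auto)
  finally show ?thesis using G(2) by (simp add: f_def p_def w_def)
qed

section \<open>The operator as a Poisson integral\<close>

lemma abs_Phi_le:
  assumes "\<alpha> > 0" shows "\<bar>Phi \<alpha> x t \<psi>\<bar> \<le> 1 / (2 * pi\<^sup>2 * \<alpha>\<^sup>2)"
proof -
  define s where "s = fst x * cos \<psi> + snd x * sin \<psi> - t"
  have E: "\<alpha>\<^sup>2 + s\<^sup>2 > 0" using assms by (simp add: add_pos_nonneg)
  have "\<bar>\<alpha>\<^sup>2 - s\<^sup>2\<bar> \<le> \<alpha>\<^sup>2 + s\<^sup>2" by (simp add: abs_le_iff)
  then have "\<bar>\<alpha>\<^sup>2 - s\<^sup>2\<bar> / (\<alpha>\<^sup>2 + s\<^sup>2)\<^sup>2 \<le> (\<alpha>\<^sup>2 + s\<^sup>2) / (\<alpha>\<^sup>2 + s\<^sup>2)\<^sup>2"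
    by (rule divide_right_mono) simp
  also have "\<dots> = 1 / (\<alpha>\<^sup>2 + s\<^sup>2)" using E by (simp add: power2_eq_square)
  also have "\<dots> \<le> 1 / \<alpha>\<^sup>2" using assms by (intro divide_left_mono) (auto simp: add_pos_nonneg)
  finally have *: "\<bar>\<alpha>\<^sup>2 - s\<^sup>2\<bar> / (\<alpha>\<^sup>2 + s\<^sup>2)\<^sup>2 \<le> 1 / \<alpha>\<^sup>2" .
  have "\<bar>Phi \<alpha> x t \<psi>\<bar> = 1 / (2 * pi\<^sup>2) * (\<bar>\<alpha>\<^sup>2 - s\<^sup>2\<bar> / (\<alpha>\<^sup>2 + s\<^sup>2)\<^sup>2)"
    by (simp add: Phi_def s_def abs_mult abs_divide)
  also have "\<dots> \<le> 1 / (2 * pi\<^sup>2) * (1 / \<alpha>\<^sup>2)" using * by (intro mult_left_mono) auto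
  finally show ?thesis by simp
qed

lemma continuous_on_Phi:
  fixes S :: "'a::t2_space set"
  assumes "\<alpha> > 0" "continuous_on S t" "continuous_on S \<psi>"
  shows "continuous_on S (\<lambda>y. Phi \<alpha> x (t y) (\<psi> y))"
proof -
  have nz: "\<alpha>\<^sup>2 + y\<^sup>2 \<noteq> 0" for y :: real using assms(1) by (simp add: sum_power2_eq_zero_iff)
  have u: "continuous_on S (\<lambda>y. fst x * cos (\<psi> y) + snd x * sin (\<psi> y) - t y)"
    by (intro continuous_on_diff continuous_on_add continuous_on_mult_left continuous_on_cos continuous_on_sin assms(2,3))
  have "continuous_on S (\<lambda>y. (\<alpha>\<^sup>2 - (fst x * cos (\<psi> y) + snd x * sin (\<psi> y) - t y)\<^sup>2) /
      (\<alpha>\<^sup>2 + (fst x * cos (\<psi> y) + snd x * sin (\<psi> y) - t y)\<^sup>2)\<^sup>2)" (is "continuous_on S ?k")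
    by (rule continuous_on_divide[OF continuous_on_diff[OF continuous_on_const continuous_on_power]
        continuous_on_power[OF continuous_on_add[OF continuous_on_const continuous_on_power]]])
       (intro u, intro u, simp only: power_eq_0_iff nz, simp)
  then show ?thesis unfolding Phi_def by (rule continuous_on_mult_left)
qed

lemma rotated_coordinate: "fst (rot \<psi> z) * cos \<psi> + snd (rot \<psi> z) * sin \<psi> = fst z"
proof -
  have "fst (rot \<psi> z) * cos \<psi> + snd (rot \<psi> z) * sin \<psi> = fst z * ((sin \<psi>)\<^sup>2 + (cos \<psi>)\<^sup>2)"
    by (simp only: rot_def fst_conv snd_conv power2_eq_square) (simp only: algebra_simps)
  then show ?thesis by simp
qed

text \<open>
  The Radon transform integrates over the lines \<open>{rot \<psi> (t, u) | u. True}\<close>, so Fubini's theorem in the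
  coordinates \<open>(t, u)\<close> together with rotation invariance turns the \<open>t\<close>-integral into an integral over
  the plane, in which \<open>t\<close> becomes the component of \<open>y\<close> in direction \<open>(cos \<psi>, sin \<psi>)\<close>.
\<close>

lemma filtered_radon_eq:
  fixes f :: "real \<times> real \<Rightarrow> complex"
  assumes \<alpha>: "\<alpha> > 0" and f: "integrable lborel f"
  shows "(LINT t|lebesgue. complex_of_real (Phi \<alpha> x t \<psi>) * radon f t \<psi>)
     = (LINT y|lborel. complex_of_real (Phi \<alpha> x (fst y * cos \<psi> + snd y * sin \<psi>) \<psi>) * f y)"
proof -
  have [measurable]: "f \<in> borel_measurable borel" using f by (simp add: borel_measurable_integrable)
  define C where "C = 1 / (2 * pi\<^sup>2 * \<alpha>\<^sup>2)"
  have C: "\<bar>Phi \<alpha> x t \<psi>\<bar> \<le> C" for t unfolding C_def by (rule abs_Phi_le[OF \<alpha>])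
  define h where "h = (\<lambda>y. complex_of_real (Phi \<alpha> x (fst y * cos \<psi> + snd y * sin \<psi>) \<psi>) * f y)"
  have [measurable]: "(\<lambda>y. Phi \<alpha> x (fst y * cos \<psi> + snd y * sin \<psi>) \<psi>) \<in> borel_measurable borel"
    "(\<lambda>t. Phi \<alpha> x t \<psi>) \<in> borel_measurable borel"
    using \<alpha> by (intro borel_measurable_continuous_onI continuous_on_Phi continuous_intros; simp)+
  have h_meas [measurable]: "h \<in> borel_measurable borel" unfolding h_def by measurable
  have "integrable lborel h"
  proof (rule Bochner_Integration.integrable_bound)
    show "integrable lborel (\<lambda>y. complex_of_real C * f y)" using f by simp
    show "AE y in lborel. norm (h y) \<le> norm (complex_of_real C * f y)"
      unfolding h_def norm_mult norm_of_real
      by (intro AE_I2 mult_right_mono order_trans[OF C abs_ge_self] norm_ge_zero)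
  qed measurable
  then have int: "integrable (lborel \<Otimes>\<^sub>M lborel) (\<lambda>z. h (rot \<psi> z))"
    using integrable_rigid[of h 0 \<psi>] by (simp add: lborel_prod)
  have h_rot: "h (rot \<psi> (t, u)) = complex_of_real (Phi \<alpha> x t \<psi>) * f (rot \<psi> (t, u))" for t u
    unfolding h_def rotated_coordinate by simp
  have radon: "radon f t \<psi> = (LINT u|lborel. f (rot \<psi> (t, u)))" for t
    unfolding radon_def by (subst integral_completion) (simp_all add: rot_def)
  have [measurable]: "(\<lambda>t. radon f t \<psi>) \<in> borel_measurable borel"
    unfolding radon by measurable
  have "(LINT t|lebesgue. complex_of_real (Phi \<alpha> x t \<psi>) * radon f t \<psi>)
      = (LINT t|lborel. complex_of_real (Phi \<alpha> x t \<psi>) * radon f t \<psi>)"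
    by (rule integral_completion) measurable
  also have "\<dots> = (LINT t|lborel. LINT u|lborel. h (rot \<psi> (t, u)))"
    unfolding h_rot radon by simp
  also have "\<dots> = (LINT z|lborel. h (rot \<psi> z))"
    using lborel_pair.integral_fst'[OF int] by (simp add: lborel_prod)
  also have "\<dots> = (LINT y|lborel. h y)" using integral_rigid[of h 0 \<psi>] by simp
  finally show ?thesis unfolding h_def .
qed

lemma integrable_pair_mult:
  fixes g :: "'a \<Rightarrow> real" and h :: "'b \<Rightarrow> real"
  assumes "sigma_finite_measure M" "sigma_finite_measure N"
    and g: "integrable M g" and h: "integrable N h"
  shows "integrable (M \<Otimes>\<^sub>M N) (\<lambda>(x, y). g x * h y)"
proof -
  interpret pair_sigma_finite M N using assms by (simp add: pair_sigma_finite_def)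
  have [measurable]: "g \<in> borel_measurable M" "h \<in> borel_measurable N" using g h by auto
  show ?thesis
  proof (rule Fubini_integrable)
    show "integrable M (\<lambda>x. LINT y|N. norm (case (x, y) of (x, y) \<Rightarrow> g x * h y))"
      using integrable_abs[OF g] by (simp add: abs_mult)
    show "AE x in M. integrable N (\<lambda>y. case (x, y) of (x, y) \<Rightarrow> g x * h y)"
      using h by simp
  qed measurable
qed

text \<open>
  The filter \<open>Phi\<close> is bounded and \<open>\<psi>\<close> ranges over a bounded interval, so the \<open>\<psi>\<close>-integral may be
  carried out first; by the angular integral it produces the Poisson kernel.
\<close>

lemma A_op_eq_poisson_integral:
  fixes f :: "real \<times> real \<Rightarrow> complex"
  assumes \<alpha>: "\<alpha> > 0" and f: "integrable lborel f"
  shows "A_op \<alpha> f x = (LINT y|lborel. complex_of_real (poisson_kernel \<alpha> (x - y)) * f y)"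
proof -
  have [measurable]: "f \<in> borel_measurable borel" using f by (simp add: borel_measurable_integrable)
  define H where "H = (\<lambda>\<psi> y. indicator {0..<pi} \<psi> *\<^sub>R (complex_of_real (Phi \<alpha> x (fst y * cos \<psi> + snd y * sin \<psi>) \<psi>) * f y))"
  have Phi_meas: "(\<lambda>z. Phi \<alpha> x (fst (snd z) * cos (fst z) + snd (snd z) * sin (fst z)) (fst z)) \<in> borel_measurable borel"
    using \<alpha> by (intro borel_measurable_continuous_onI continuous_on_Phi continuous_intros; simp)
  then have [measurable]: "(\<lambda>z. Phi \<alpha> x (fst (snd z) * cos (fst z) + snd (snd z) * sin (fst z)) (fst z))
     \<in> borel_measurable (borel \<Otimes>\<^sub>M borel)"
    by (simp add: borel_prod)
  have H_meas: "(\<lambda>(\<psi>, y). H \<psi> y) \<in> borel_measurable (borel \<Otimes>\<^sub>M borel)"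
    unfolding H_def case_prod_beta by measurable
  define C where "C = 1 / (2 * pi\<^sup>2 * \<alpha>\<^sup>2)"
  have H_le: "norm (H \<psi> y) \<le> indicator {0..<pi} \<psi> * (C * norm (f y))" for \<psi> y
  proof -
    have "\<bar>Phi \<alpha> x (fst y * cos \<psi> + snd y * sin \<psi>) \<psi>\<bar> * norm (f y) \<le> C * norm (f y)"
      unfolding C_def by (intro mult_right_mono abs_Phi_le[OF \<alpha>] norm_ge_zero)
    then show ?thesis unfolding H_def by (simp add: indicator_def norm_mult)
  qed
  have int: "integrable (lborel \<Otimes>\<^sub>M lborel) (case_prod H)"
  proof (rule Bochner_Integration.integrable_bound)
    show "integrable (lborel \<Otimes>\<^sub>M lborel) (\<lambda>(\<psi>, y). indicat_real {0..<pi} \<psi> * (C * norm (f y)))"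
      using f by (intro integrable_pair_mult) (auto intro: lborel.sigma_finite_measure_axioms)
    show "AE z in lborel \<Otimes>\<^sub>M lborel. norm (case_prod H z) \<le> norm (case z of (\<psi>, y) \<Rightarrow> indicat_real {0..<pi} \<psi> * (C * norm (f y)))"
      using H_le by (intro AE_I2) (auto intro: order_trans[OF _ abs_ge_self])
  qed (use H_meas in simp)
  have inner: "(LINT \<psi>|lborel. H \<psi> y) = complex_of_real (poisson_kernel \<alpha> (x - y)) * f y" for y
  proof -
    define a b where "a = fst x - fst y" and "b = snd x - snd y"
    have Phi: "Phi \<alpha> x (fst y * cos \<psi> + snd y * sin \<psi>) \<psi> = 1 / (2 * pi\<^sup>2) *
       ((\<alpha>\<^sup>2 - (a * cos \<psi> + b * sin \<psi>)\<^sup>2) / (\<alpha>\<^sup>2 + (a * cos \<psi> + b * sin \<psi>)\<^sup>2)\<^sup>2)" for \<psi>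
    proof -
      have "fst x * cos \<psi> + snd x * sin \<psi> - (fst y * cos \<psi> + snd y * sin \<psi>) = a * cos \<psi> + b * sin \<psi>"
        by (simp add: a_def b_def algebra_simps)
      then show ?thesis unfolding Phi_def by simp
    qed
    have "(LINT \<psi>|lborel. H \<psi> y) = (LINT \<psi>|lborel. complex_of_real (indicator {0..<pi} \<psi> *\<^sub>R Phi \<alpha> x (fst y * cos \<psi> + snd y * sin \<psi>) \<psi>) * f y)"
      unfolding H_def by (simp add: scaleR_conv_of_real mult_ac)
    also have "\<dots> = complex_of_real (LINT \<psi>|lborel. indicator {0..<pi} \<psi> *\<^sub>R Phi \<alpha> x (fst y * cos \<psi> + snd y * sin \<psi>) \<psi>) * f y"
      by (simp only: integral_mult_left_zero integral_complex_of_real)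
    also have "(LINT \<psi>|lborel. indicator {0..<pi} \<psi> *\<^sub>R Phi \<alpha> x (fst y * cos \<psi> + snd y * sin \<psi>) \<psi>)
       = 1 / (2 * pi\<^sup>2) * (pi * \<alpha> / sqrt (\<alpha>\<^sup>2 + (a\<^sup>2 + b\<^sup>2)) ^ 3)"
      unfolding Phi set_lebesgue_integral_def[symmetric] set_integral_mult_right angular_integral[OF \<alpha>] ..
    also have "\<dots> = poisson_kernel \<alpha> (x - y)"
      by (simp add: poisson_kernel_def norm_prod_def a_def b_def power2_eq_square)
    finally show ?thesis .
  qed
  have [measurable]: "(\<lambda>\<psi>. LINT y|lborel. H \<psi> y) \<in> borel_measurable borel"
  proof (rule lborel.borel_measurable_lebesgue_integral)
    show "case_prod H \<in> borel_measurable (borel \<Otimes>\<^sub>M lborel)"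
      using H_meas by (subst measurable_cong_sets[OF sets_pair_measure_cong[OF refl sets_lborel] refl])
  qed
  have "A_op \<alpha> f x = (LINT \<psi>|lebesgue. LINT y|lborel. H \<psi> y)"
    unfolding A_op_def set_lebesgue_integral_def filtered_radon_eq[OF \<alpha> f] H_def by simp
  also have "\<dots> = (LINT \<psi>|lborel. LINT y|lborel. H \<psi> y)"
    by (rule integral_completion) measurable
  also have "\<dots> = (LINT y|lborel. LINT \<psi>|lborel. H \<psi> y)"
    by (rule lborel_pair.Fubini_integral[OF int, symmetric])
  finally show ?thesis unfolding inner .
qed

section \<open>Averages over rotations and over circles\<close>

text \<open>
  For small \<open>z\<close> this will be the circle average of radius \<open>norm z\<close>. As a function of \<open>z\<close> in the plane it replaces
  integration in polar coordinates: a plane integral is averaged over rotations, rather than split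
  into a radial and an angular part.
\<close>

definition rotation_average :: "(real \<times> real \<Rightarrow> complex) \<Rightarrow> real \<times> real \<Rightarrow> real \<times> real \<Rightarrow> complex" where
  "rotation_average g x z = 1 / (2 * complex_of_real pi) * (LINT \<theta>:{0..2*pi}|lborel. g (x + rot \<theta> z))"

lemma rotation_average:
  fixes g :: "real \<times> real \<Rightarrow> complex"
  assumes g: "integrable lborel g"
  shows integrable_rotation_average: "integrable lborel (rotation_average g x)"
    and integral_rotation_average: "(LINT z|lborel. rotation_average g x z) = (LINT y|lborel. g y)"
proof -
  have [measurable]: "g \<in> borel_measurable borel" using g by (simp add: borel_measurable_integrable)
  define H where "H = (\<lambda>\<theta> z. indicator {0..2*pi} \<theta> *\<^sub>R g (x + rot \<theta> z))"
  have "(\<lambda>z. x + rot (fst z) (snd z)) \<in> borel_measurable borel"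
    unfolding rot_def by (intro borel_measurable_continuous_onI continuous_intros)
  then have [measurable]: "(\<lambda>z. x + rot (fst z) (snd z)) \<in> borel_measurable (borel \<Otimes>\<^sub>M borel)"
    by (simp add: borel_prod)
  have H_meas: "case_prod H \<in> borel_measurable (borel \<Otimes>\<^sub>M borel)"
    unfolding H_def case_prod_beta by measurable
  have int1: "integrable lborel (\<lambda>z. g (x + rot \<theta> z))" for \<theta>
    using integrable_rigid[of g x \<theta>] g by simp
  have norm1: "(LINT z|lborel. norm (g (x + rot \<theta> z))) = (LINT y|lborel. norm (g y))" for \<theta>
    using integral_rigid[of "\<lambda>y. norm (g y)" x \<theta>] by simp
  have int: "integrable (lborel \<Otimes>\<^sub>M lborel) (case_prod H)"
  proof (rule lborel_pair.Fubini_integrable)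
    show "case_prod H \<in> borel_measurable (lborel \<Otimes>\<^sub>M lborel)" using H_meas by simp
    show "integrable lborel (\<lambda>\<theta>. LINT z|lborel. norm (case (\<theta>, z) of (\<theta>, z) \<Rightarrow> H \<theta> z))"
      by (simp add: H_def norm1)
    show "AE \<theta> in lborel. integrable lborel (\<lambda>z. case (\<theta>, z) of (\<theta>, z) \<Rightarrow> H \<theta> z)"
      using int1 by (simp add: H_def)
  qed
  have avg: "rotation_average g x = (\<lambda>z. 1 / (2 * complex_of_real pi) * (LINT \<theta>|lborel. H \<theta> z))"
    by (simp add: rotation_average_def set_lebesgue_integral_def H_def fun_eq_iff)
  show "integrable lborel (rotation_average g x)"
    unfolding avg by (intro integrable_mult_right lborel_pair.integrable_snd int)
  have "(LINT z|lborel. rotation_average g x z) = 1 / (2 * complex_of_real pi) * (LINT z|lborel. LINT \<theta>|lborel. H \<theta> z)"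
    unfolding avg by simp
  also have "(LINT z|lborel. LINT \<theta>|lborel. H \<theta> z) = (LINT \<theta>|lborel. LINT z|lborel. H \<theta> z)"
    by (rule lborel_pair.Fubini_integral[OF int])
  also have "\<dots> = (LINT \<theta>|lborel. indicator {0..2*pi} \<theta> *\<^sub>R (LINT y|lborel. g y))"
    by (simp add: H_def integral_rigid)
  also have "\<dots> = (2 * complex_of_real pi) * (LINT y|lborel. g y)"
    by (simp add: scaleR_conv_of_real)
  finally show "(LINT z|lborel. rotation_average g x z) = (LINT y|lborel. g y)" by simp
qed

lemma rotation_average_radial_mult:
  assumes "\<And>\<theta> z. k (x + rot \<theta> z) = complex_of_real (K z)"
  shows "rotation_average (\<lambda>y. k y * f y) x z = complex_of_real (K z) * rotation_average f x z"
proof -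
  have "(LINT \<theta>:{0..2*pi}|lborel. k (x + rot \<theta> z) * f (x + rot \<theta> z))
     = complex_of_real (K z) * (LINT \<theta>:{0..2*pi}|lborel. f (x + rot \<theta> z))"
    unfolding assms by simp
  then show ?thesis unfolding rotation_average_def by simp
qed

text \<open>
  The kernel centred at \<open>x\<close> is invariant under rotations about \<open>x\<close>, so only \<open>f\<close> is averaged.
\<close>

lemma A_op_eq_rotation_average:
  fixes f :: "real \<times> real \<Rightarrow> complex"
  assumes \<alpha>: "\<alpha> > 0" and f: "integrable lborel f"
  shows "A_op \<alpha> f x = (LINT z|lborel. complex_of_real (poisson_kernel \<alpha> z) * rotation_average f x z)"
proof -
  have [measurable]: "f \<in> borel_measurable borel" using f by (simp add: borel_measurable_integrable)
  let ?k = "\<lambda>y. complex_of_real (poisson_kernel \<alpha> (x - y))"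
  have "integrable lborel (\<lambda>y. ?k y * f y)"
  proof (rule Bochner_Integration.integrable_bound)
    show "integrable lborel (\<lambda>y. complex_of_real (1 / (2 * pi * \<alpha>\<^sup>2)) * f y)" using f by simp
    show "AE y in lborel. norm (?k y * f y) \<le> norm (complex_of_real (1 / (2 * pi * \<alpha>\<^sup>2)) * f y)"
      unfolding norm_mult norm_of_real
      by (intro AE_I2 mult_right_mono norm_ge_zero abs_poisson_kernel_le \<alpha>)
  qed measurable
  from integral_rotation_average[OF this, of x]
  have "A_op \<alpha> f x = (LINT z|lborel. rotation_average (\<lambda>y. ?k y * f y) x z)"
    by (simp add: A_op_eq_poisson_integral[OF \<alpha> f])
  also have "rotation_average (\<lambda>y. ?k y * f y) x = (\<lambda>z. complex_of_real (poisson_kernel \<alpha> z) * rotation_average f x z)"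
    by (intro ext rotation_average_radial_mult) (simp add: poisson_kernel_def)
  finally show ?thesis .
qed

lemma circle_average_eq:
  assumes [measurable]: "f \<in> borel_measurable borel"
  shows "circle_average r f x = 1 / (2 * complex_of_real pi) * (LINT \<theta>:{0..2*pi}|lborel. f (x + r *\<^sub>R (cos \<theta>, sin \<theta>)))"
proof -
  have [measurable]: "(\<lambda>\<theta>. x + r *\<^sub>R (cos \<theta>, sin \<theta>)) \<in> borel_measurable borel"
    by (intro borel_measurable_continuous_onI continuous_intros)
  have eq: "(fst x + r * cos \<theta>, snd x + r * sin \<theta>) = x + r *\<^sub>R (cos \<theta>, sin \<theta>)" for \<theta>
    by (simp add: prod_eq_iff)
  show ?thesis unfolding circle_average_def eq set_lebesgue_integral_def
    by (subst integral_completion) auto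
qed

lemma set_integral_periodic_shift:
  fixes g :: "real \<Rightarrow> complex"
  assumes [measurable]: "g \<in> borel_measurable borel" and bd: "\<And>\<theta>. norm (g \<theta>) \<le> M"
    and per: "\<And>\<theta>. g (\<theta> + 2 * pi) = g \<theta>" and \<beta>: "0 \<le> \<beta>" "\<beta> \<le> 2 * pi"
  shows "(LINT \<theta>:{0..2*pi}|lborel. g (\<theta> + \<beta>)) = (LINT \<theta>:{0..2*pi}|lborel. g \<theta>)"
proof -
  have int: "set_integrable lborel {a..b} g" for a b
    unfolding set_integrable_def
  proof (rule Bochner_Integration.integrable_bound)
    show "integrable lborel (\<lambda>\<theta>. indicat_real {a..b} \<theta> * M)"
      by (intro integrable_mult_left integrable_real_indicator) (auto simp: emeasure_lborel_Icc_eq)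
    show "AE \<theta> in lborel. norm (indicat_real {a..b} \<theta> *\<^sub>R g \<theta>) \<le> norm (indicat_real {a..b} \<theta> * M)"
      using bd by (intro AE_I2) (auto simp: indicator_def intro: order_trans[OF _ abs_ge_self])
  qed measurable
  have shift: "(LINT \<theta>:{a..b}|lborel. g (\<theta> + c)) = (LINT \<theta>:{a+c..b+c}|lborel. g \<theta>)" for a b c
  proof -
    have "indicator {a+c..b+c} (c + \<theta>) = (indicator {a..b} \<theta> :: real)" for \<theta> by (simp add: indicator_def)
    then show ?thesis
      using lborel_integral_real_affine[of 1 "\<lambda>\<theta>. indicator {a+c..b+c} \<theta> *\<^sub>R g \<theta>" c]
      by (simp add: set_lebesgue_integral_def add.commute)
  qed
  have split: "(LINT \<theta>:{a..c}|lborel. g \<theta>) = (LINT \<theta>:{a..b}|lborel. g \<theta>) + (LINT \<theta>:{b..c}|lborel. g \<theta>)"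
    if "a \<le> b" "b \<le> c" for a b c
  proof -
    have "(LINT \<theta>:{a..b} \<union> {b..c}|lborel. g \<theta>) = (LINT \<theta>:{a..b}|lborel. g \<theta>) + (LINT \<theta>:{b..c}|lborel. g \<theta>)"
      by (rule set_integral_Un_AE)
        (use int AE_lborel_singleton[of b] in \<open>auto elim!: eventually_mono\<close>)
    moreover have "{a..b} \<union> {b..c} = {a..c}" using that by auto
    ultimately show ?thesis by simp
  qed
  have "(LINT \<theta>:{0..2*pi}|lborel. g (\<theta> + \<beta>)) = (LINT \<theta>:{\<beta>..2*pi+\<beta>}|lborel. g \<theta>)"
    using shift[of 0 "2 * pi" \<beta>] by simp
  also have "\<dots> = (LINT \<theta>:{\<beta>..2*pi}|lborel. g \<theta>) + (LINT \<theta>:{2*pi..2*pi+\<beta>}|lborel. g \<theta>)"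
    using \<beta> by (intro split) auto
  also have "(LINT \<theta>:{2*pi..2*pi+\<beta>}|lborel. g \<theta>) = (LINT \<theta>:{0..\<beta>}|lborel. g \<theta>)"
    using shift[of 0 \<beta> "2 * pi"] by (simp add: per add.commute)
  also have "(LINT \<theta>:{\<beta>..2*pi}|lborel. g \<theta>) + \<dots> = (LINT \<theta>:{0..2*pi}|lborel. g \<theta>)"
    using split[of 0 \<beta> "2 * pi"] \<beta> by simp
  finally show ?thesis .
qed

text \<open>
  If \<open>z\<close> has polar angle \<open>\<beta>\<close>, then the two averages differ by the shift \<open>\<beta>\<close> of the angle, which does
  not change the integral over a period. The local bound on \<open>f\<close> ensures integrability on this very
  circle; Fubini's theorem alone would give it only for almost every radius.
\<close>

lemma rotation_average_eq_circle_average: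
  assumes [measurable]: "f \<in> borel_measurable borel"
    and bd: "\<And>y. norm (y - x) \<le> norm z \<Longrightarrow> norm (f y) \<le> M"
  shows "rotation_average f x z = circle_average (norm z) f x"
proof -
  have [measurable]: "(\<lambda>\<theta>. x + norm z *\<^sub>R (cos \<theta>, sin \<theta>)) \<in> borel_measurable borel"
    by (intro borel_measurable_continuous_onI continuous_intros)
  have "\<exists>\<beta>. 0 \<le> \<beta> \<and> \<beta> \<le> 2 * pi \<and> z = norm z *\<^sub>R (cos \<beta>, sin \<beta>)"
  proof (cases "z = 0")
    case True then show ?thesis by (intro exI[of _ 0]) (simp add: zero_prod_def)
  next
    case False
    have "(fst z / norm z)\<^sup>2 + (snd z / norm z)\<^sup>2 = 1"
      using False by (simp add: norm_prod_def power_divide add_divide_distrib[symmetric] prod_eq_iff sum_power2_eq_zero_iff)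
    then obtain \<beta> where \<beta>: "0 \<le> \<beta>" "\<beta> \<le> 2 * pi" "fst z / norm z = cos \<beta>" "snd z / norm z = sin \<beta>"
      using sincos_total_2pi_le by blast
    then have "fst z = norm z * cos \<beta>" "snd z = norm z * sin \<beta>"
      using False by (simp_all add: nonzero_divide_eq_eq mult.commute)
    then have "z = norm z *\<^sub>R (cos \<beta>, sin \<beta>)"
      by (intro prod_eqI) simp_all
    then show ?thesis using \<beta>(1,2) by blast
  qed
  then obtain \<beta> where \<beta>: "0 \<le> \<beta>" "\<beta> \<le> 2 * pi" and z: "z = norm z *\<^sub>R (cos \<beta>, sin \<beta>)" by blast
  have fz: "fst z = norm z * cos \<beta>" "snd z = norm z * sin \<beta>"
    using arg_cong[OF z, of fst] arg_cong[OF z, of snd] by simp_all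
  have rot: "rot \<theta> z = norm z *\<^sub>R (cos (\<theta> + \<beta>), sin (\<theta> + \<beta>))" for \<theta>
    unfolding rot_def fz by (simp add: cos_add sin_add algebra_simps)
  define g where "g = (\<lambda>\<theta>. f (x + norm z *\<^sub>R (cos \<theta>, sin \<theta>)))"
  have "(LINT \<theta>:{0..2*pi}|lborel. g (\<theta> + \<beta>)) = (LINT \<theta>:{0..2*pi}|lborel. g \<theta>)"
  proof (rule set_integral_periodic_shift[where M=M])
    show "g \<in> borel_measurable borel" unfolding g_def by measurable
    show "norm (g \<theta>) \<le> M" for \<theta>
      unfolding g_def by (rule bd) (simp add: norm_prod_def abs_mult power_mult_distrib flip: distrib_left)
    show "g (\<theta> + 2 * pi) = g \<theta>" for \<theta> by (simp add: g_def)
  qed fact+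
  then show ?thesis unfolding rotation_average_def circle_average_eq[OF assms(1)] rot g_def by simp
qed

section \<open>Rays and piecewise smooth boundaries\<close>

definition lies_off :: "(real \<times> real) set \<Rightarrow> real \<times> real \<Rightarrow> real \<times> real \<Rightarrow> bool" where
  "lies_off A x u \<longleftrightarrow> (\<forall>\<^sub>F r in at_right 0. x + r *\<^sub>R u \<notin> A)"

lemma sgn_difference_quotient_tendsto:
  fixes \<gamma> :: "real \<Rightarrow> 'a::real_normed_vector"
  assumes "(\<gamma> has_vector_derivative v) (at s within S)" "v \<noteq> 0"
  shows "((\<lambda>t. sgn ((1 / (t - s)) *\<^sub>R (\<gamma> t - \<gamma> s))) \<longlongrightarrow> sgn v) (at s within S)"
proof -
  have "((\<lambda>t. (1 / (t - s)) *\<^sub>R (\<gamma> t - \<gamma> s)) \<longlongrightarrow> v) (at s within S)"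
  proof -
    have "((\<lambda>t. norm ((\<gamma> t - \<gamma> s) - (t - s) *\<^sub>R v) / norm (t - s)) \<longlongrightarrow> 0) (at s within S)"
      using assms(1) by (simp add: has_vector_derivative_def has_derivative_iff_norm)
    then have "((\<lambda>t. norm ((1 / (t - s)) *\<^sub>R (\<gamma> t - \<gamma> s) - v)) \<longlongrightarrow> 0) (at s within S)"
    proof (rule Lim_transform_eventually)
      have "norm ((\<gamma> t - \<gamma> s) - (t - s) *\<^sub>R v) / norm (t - s) = norm ((1 / (t - s)) *\<^sub>R (\<gamma> t - \<gamma> s) - v)"
        if "t \<noteq> s" for t
      proof -
        have "(1 / (t - s)) *\<^sub>R (\<gamma> t - \<gamma> s) - v = (1 / (t - s)) *\<^sub>R ((\<gamma> t - \<gamma> s) - (t - s) *\<^sub>R v)"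
          using that by (simp add: scaleR_diff_right)
        then show ?thesis by simp
      qed
      then show "\<forall>\<^sub>F t in at s within S. norm ((\<gamma> t - \<gamma> s) - (t - s) *\<^sub>R v) / norm (t - s) =
          norm ((1 / (t - s)) *\<^sub>R (\<gamma> t - \<gamma> s) - v)"
        by (simp add: eventually_at_filter)
    qed
    then show ?thesis by (simp add: Lim_null[of _ v] tendsto_norm_zero_iff)
  qed
  then show ?thesis using assms(2) by (rule tendsto_sgn)
qed

text \<open>
  At an end point of a smooth arc the chords approach the direction of the one-sided tangent, so no
  other direction is the direction of arbitrarily short chords.
\<close>

lemma smooth_arc_tangents:
  assumes "smooth_arc_on c d \<gamma>" "c < d"
  shows "\<exists>v. \<forall>u. u \<noteq> v \<longrightarrow> (\<forall>\<^sub>F t in at_right c. sgn (\<gamma> t - \<gamma> c) \<noteq> u)"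
    and "\<exists>v. \<forall>u. u \<noteq> v \<longrightarrow> (\<forall>\<^sub>F t in at_left d. sgn (\<gamma> t - \<gamma> d) \<noteq> u)"
proof -
  obtain \<gamma>' where D: "\<And>t. t \<in> {c..d} \<Longrightarrow> (\<gamma> has_vector_derivative \<gamma>' t) (at t within {c..d}) \<and> \<gamma>' t \<noteq> 0"
    using assms(1) unfolding smooth_arc_on_def by blast
  have sgn_eq: "sgn ((1 / (t - s)) *\<^sub>R (\<gamma> t - \<gamma> s)) = sgn (t - s) *\<^sub>R sgn (\<gamma> t - \<gamma> s)" for s t
    by (simp add: sgn_scaleR sgn_divide)
  have R: "at c within {c..d} = at_right c" and L: "at d within {c..d} = at_left d"
    using assms(2) by (simp_all add: at_within_Icc_at_right at_within_Icc_at_left)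
  have "((\<lambda>t. sgn (t - c) *\<^sub>R sgn (\<gamma> t - \<gamma> c)) \<longlongrightarrow> sgn (\<gamma>' c)) (at_right c)"
    using sgn_difference_quotient_tendsto[of \<gamma> "\<gamma>' c" c "{c..d}"] D[of c] assms(2) by (simp add: sgn_eq R)
  then have "((\<lambda>t. sgn (\<gamma> t - \<gamma> c)) \<longlongrightarrow> sgn (\<gamma>' c)) (at_right c)"
    by (rule Lim_transform_eventually) (auto simp: eventually_at_filter)
  then show "\<exists>v. \<forall>u. u \<noteq> v \<longrightarrow> (\<forall>\<^sub>F t in at_right c. sgn (\<gamma> t - \<gamma> c) \<noteq> u)"
    by (intro exI[of _ "sgn (\<gamma>' c)"]) (metis tendsto_imp_eventually_ne)
  have "((\<lambda>t. sgn (t - d) *\<^sub>R sgn (\<gamma> t - \<gamma> d)) \<longlongrightarrow> sgn (\<gamma>' d)) (at_left d)"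
    using sgn_difference_quotient_tendsto[of \<gamma> "\<gamma>' d" d "{c..d}"] D[of d] assms(2) by (simp add: sgn_eq L)
  then have "((\<lambda>t. - sgn (\<gamma> t - \<gamma> d)) \<longlongrightarrow> sgn (\<gamma>' d)) (at_left d)"
    by (rule Lim_transform_eventually) (auto simp: eventually_at_filter)
  from tendsto_minus[OF this] have "((\<lambda>t. sgn (\<gamma> t - \<gamma> d)) \<longlongrightarrow> - sgn (\<gamma>' d)) (at_left d)" by simp
  then show "\<exists>v. \<forall>u. u \<noteq> v \<longrightarrow> (\<forall>\<^sub>F t in at_left d. sgn (\<gamma> t - \<gamma> d) \<noteq> u)"
    by (intro exI[of _ "- sgn (\<gamma>' d)"]) (metis tendsto_imp_eventually_ne)
qed

lemma discrete_gap:
  fixes P :: "real set"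
  assumes "\<And>a b. finite (P \<inter> {a..b})"
  obtains e where "e > 0" "{s<..<s + e} \<inter> P = {}" "{s - e<..<s} \<inter> P = {}"
proof -
  have "\<not> s islimpt P"
  proof
    assume "s islimpt P"
    then have "infinite (P \<inter> ball s 1)" by (simp add: islimpt_eq_infinite_ball)
    moreover have "finite (P \<inter> ball s 1)"
      by (rule finite_subset[OF _ assms[of "s - 1" "s + 1"]]) (auto simp: dist_real_def)
    ultimately show False by simp
  qed
  then obtain e where "e > 0" "\<And>y. y \<in> P \<Longrightarrow> y \<noteq> s \<Longrightarrow> dist y s \<ge> e"
    unfolding islimpt_approachable by (meson not_less)
  then show thesis by (intro that[of e]) (force simp: dist_real_def)+
qed

text \<open>
  Since corners are isolated, the curve is a smooth arc on each side of any parameter \<open>s\<close>, even when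
  \<open>s\<close> is itself a corner or a cusp; the exceptional directions are those of the two one-sided tangents.
\<close>

lemma piecewise_smooth_curve_local_directions:
  assumes "piecewise_smooth_curve_on I \<gamma>" "is_interval I" "s \<in> I"
  shows "\<exists>B. finite B \<and> (\<forall>u. u \<notin> B \<longrightarrow> (\<forall>\<^sub>F t in at s within I. sgn (\<gamma> t - \<gamma> s) \<noteq> u))"
proof -
  obtain P where P: "\<And>a b. finite (P \<inter> {a..b})"
    and arc: "\<And>c d. c < d \<Longrightarrow> {c..d} \<subseteq> I \<Longrightarrow> {c<..<d} \<inter> P = {} \<Longrightarrow> smooth_arc_on c d \<gamma>"
    using assms(1) unfolding piecewise_smooth_curve_on_def by meson
  obtain e where e: "e > 0" "{s<..<s + e} \<inter> P = {}" "{s - e<..<s} \<inter> P = {}"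
    using discrete_gap[OF P] by blast
  have Icc: "{a..b} \<subseteq> I" if "a \<in> I" "b \<in> I" for a b
    using assms(2) that by (meson atLeastAtMost_iff is_interval_1 subsetI)
  have "\<exists>v. \<forall>u. u \<noteq> v \<longrightarrow> (\<forall>\<^sub>F t in at_right s. t \<in> I \<longrightarrow> sgn (\<gamma> t - \<gamma> s) \<noteq> u)"
  proof (cases "\<exists>t\<in>I. s < t")
    case True
    then obtain t where t: "t \<in> I" "s < t" by blast
    define d where "d = min t (s + e)"
    have "d \<in> I" using Icc[OF assms(3) t(1)] t e by (auto simp: d_def min_def)
    have "smooth_arc_on s d \<gamma>"
      using e t by (intro arc Icc \<open>d \<in> I\<close> assms) (auto simp: d_def)
    moreover have "s < d" using t e by (auto simp: d_def)
    ultimately obtain v where "\<forall>u. u \<noteq> v \<longrightarrow> (\<forall>\<^sub>F t in at_right s. sgn (\<gamma> t - \<gamma> s) \<noteq> u)"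
      using smooth_arc_tangents(1) by blast
    then show ?thesis by (intro exI[of _ v] allI impI) (blast intro: eventually_mono)
  next
    case False
    then show ?thesis
      by (intro exI[of _ undefined] allI impI) (auto simp: eventually_at_filter intro!: always_eventually)
  qed
  moreover have "\<exists>v. \<forall>u. u \<noteq> v \<longrightarrow> (\<forall>\<^sub>F t in at_left s. t \<in> I \<longrightarrow> sgn (\<gamma> t - \<gamma> s) \<noteq> u)"
  proof (cases "\<exists>t\<in>I. t < s")
    case True
    then obtain t where t: "t \<in> I" "t < s" by blast
    define d where "d = max t (s - e)"
    have "d \<in> I" using Icc[OF t(1) assms(3)] t e by (auto simp: d_def max_def)
    have "smooth_arc_on d s \<gamma>"
      using e t by (intro arc Icc \<open>d \<in> I\<close> assms) (auto simp: d_def)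
    moreover have "d < s" using t e by (auto simp: d_def)
    ultimately obtain v where "\<forall>u. u \<noteq> v \<longrightarrow> (\<forall>\<^sub>F t in at_left s. sgn (\<gamma> t - \<gamma> s) \<noteq> u)"
      using smooth_arc_tangents(2) by blast
    then show ?thesis by (intro exI[of _ v] allI impI) (blast intro: eventually_mono)
  next
    case False
    then show ?thesis
      by (intro exI[of _ undefined] allI impI) (auto simp: eventually_at_filter intro!: always_eventually)
  qed
  ultimately obtain v w where
    v: "\<forall>u. u \<noteq> v \<longrightarrow> (\<forall>\<^sub>F t in at_right s. t \<in> I \<longrightarrow> sgn (\<gamma> t - \<gamma> s) \<noteq> u)"
    and w: "\<forall>u. u \<noteq> w \<longrightarrow> (\<forall>\<^sub>F t in at_left s. t \<in> I \<longrightarrow> sgn (\<gamma> t - \<gamma> s) \<noteq> u)"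
    by (elim exE)
  have "\<forall>\<^sub>F t in at s within I. sgn (\<gamma> t - \<gamma> s) \<noteq> u" if "u \<notin> {v, w}" for u
  proof -
    have "\<forall>\<^sub>F t in at_right s. t \<in> I \<longrightarrow> sgn (\<gamma> t - \<gamma> s) \<noteq> u"
      "\<forall>\<^sub>F t in at_left s. t \<in> I \<longrightarrow> sgn (\<gamma> t - \<gamma> s) \<noteq> u"
      using that v w by blast+
    then show ?thesis
      unfolding eventually_at_filter by eventually_elim (auto simp: neq_iff)
  qed
  then show ?thesis by (intro exI[of _ "{v, w}"]) auto
qed

text \<open>
  A second parameter \<open>t\<close> with the value of \<open>s\<close> satisfies \<open>closed_segment s t = I\<close>, and this determines
  \<open>t\<close> from \<open>s\<close>: no point is attained more than twice.
\<close>

lemma simple_curve_fibre_finite: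
  fixes \<gamma> :: "real \<Rightarrow> 'a"
  assumes "\<forall>s\<in>I. \<forall>t\<in>I. \<gamma> s = \<gamma> t \<longrightarrow> s = t \<or> closed_segment s t = I"
  shows "finite {s\<in>I. \<gamma> s = x}"
proof (cases "\<exists>s\<in>I. \<gamma> s = x")
  case True
  then obtain s where s: "s \<in> I" "\<gamma> s = x" by blast
  have "t = t'" if "t \<in> I" "\<gamma> t = x" "t \<noteq> s" "t' \<in> I" "\<gamma> t' = x" "t' \<noteq> s" for t t'
  proof -
    have "closed_segment s t = I" "closed_segment s t' = I" using assms s that by metis+
    then have "closed_segment s t = closed_segment s t'" by simp
    then show ?thesis using Starlike.closed_segment_eq[of s t s t'] by (auto simp: doubleton_eq_iff)
  qed
  then have "\<exists>t. {s\<in>I. \<gamma> s = x} \<subseteq> {s, t}" by blast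
  then show ?thesis using finite_subset by blast
next
  case False
  then have e: "{s\<in>I. \<gamma> s = x} = {}" by blast
  show ?thesis unfolding e by simp
qed

text \<open>
  The part of the curve within distance 1 of \<open>x\<close> has a compact parameter set, by properness. Near the
  finitely many parameters mapped to \<open>x\<close>, the ray in direction \<open>u\<close> is avoided because \<open>u\<close> is not a
  tangent direction; the other parameters form a compact set whose image has positive distance
  from \<open>x\<close>.
\<close>

lemma eventually_ray_avoids_curve:
  assumes "simple_piecewise_smooth_curve C"
  shows "\<exists>B. finite B \<and> (\<forall>u. norm u = 1 \<and> u \<notin> B \<longrightarrow> lies_off C x u)"
proof -
  obtain I \<gamma> where I: "is_interval I" "closed I" and \<gamma>: "piecewise_smooth_curve_on I \<gamma>" and C: "C = \<gamma> ` I"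
    and inj: "\<forall>s\<in>I. \<forall>t\<in>I. \<gamma> s = \<gamma> t \<longrightarrow> s = t \<or> closed_segment s t = I"
    and proper: "\<And>B. bounded B \<Longrightarrow> bounded {t \<in> I. \<gamma> t \<in> B}"
    using assms unfolding simple_piecewise_smooth_curve_def by blast
  have cont: "continuous_on I \<gamma>" using \<gamma> by (simp add: piecewise_smooth_curve_on_def)
  define S where "S = {s\<in>I. \<gamma> s = x}"
  have "finite S" unfolding S_def by (rule simple_curve_fibre_finite[OF inj])
  have "\<forall>s\<in>S. \<exists>B. finite B \<and> (\<forall>u. u \<notin> B \<longrightarrow> (\<forall>\<^sub>F t in at s within I. sgn (\<gamma> t - \<gamma> s) \<noteq> u))"
    using piecewise_smooth_curve_local_directions[OF \<gamma> I(1)] by (auto simp: S_def)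
  then obtain B where B: "\<And>s. s \<in> S \<Longrightarrow> finite (B s)"
    "\<And>s u. s \<in> S \<Longrightarrow> u \<notin> B s \<Longrightarrow> \<forall>\<^sub>F t in at s within I. sgn (\<gamma> t - \<gamma> s) \<noteq> u" by metis
  have "lies_off C x u" if u: "norm u = 1" "u \<notin> (\<Union>s\<in>S. B s)" for u
  proof -
    have "\<forall>s\<in>S. \<exists>W. open W \<and> s \<in> W \<and> (\<forall>t\<in>W. t \<noteq> s \<longrightarrow> t \<in> I \<longrightarrow> sgn (\<gamma> t - \<gamma> s) \<noteq> u)"
      using B(2) u(2) unfolding eventually_at_topological by auto
    then obtain W where W: "\<And>s. s \<in> S \<Longrightarrow> open (W s)" "\<And>s. s \<in> S \<Longrightarrow> s \<in> W s"
      "\<And>s t. s \<in> S \<Longrightarrow> t \<in> W s \<Longrightarrow> t \<noteq> s \<Longrightarrow> t \<in> I \<Longrightarrow> sgn (\<gamma> t - \<gamma> s) \<noteq> u"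
      by metis
    define K where "K = (I \<inter> \<gamma> -` cball x 1) - (\<Union>s\<in>S. W s)"
    have "closed (I \<inter> \<gamma> -` cball x 1)"
      using cont I(2) by (intro continuous_closed_preimage) auto
    moreover have "bounded (I \<inter> \<gamma> -` cball x 1)"
      using proper[of "cball x 1"] by (simp add: vimage_def Int_def)
    ultimately have "compact (I \<inter> \<gamma> -` cball x 1)" by (simp add: compact_eq_bounded_closed)
    then have "compact K" unfolding K_def using W(1) by (intro compact_diff open_UN) auto
    then have "compact (\<gamma> ` K)" by (intro compact_continuous_image continuous_on_subset[OF cont]) (auto simp: K_def)
    moreover have "x \<notin> \<gamma> ` K" using W(2) by (auto simp: K_def S_def)
    ultimately have "open (- \<gamma> ` K)" "x \<in> - \<gamma> ` K" by (auto simp: compact_imp_closed open_Compl)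
    then obtain d where d: "d > 0" "ball x d \<subseteq> - \<gamma> ` K" using open_contains_ball by blast
    have "x + r *\<^sub>R u \<notin> C" if r: "0 < r" "r < min d 1" for r
    proof
      assume "x + r *\<^sub>R u \<in> C"
      then obtain t where t: "t \<in> I" "\<gamma> t = x + r *\<^sub>R u" by (auto simp: C)
      have dist: "dist x (\<gamma> t) = r" using t r u by (simp add: dist_norm)
      then have "t \<notin> K" using d(2) r by auto
      then obtain s where s: "s \<in> S" "t \<in> W s" using t(1) dist r by (auto simp: K_def)
      have "\<gamma> s = x" using s(1) by (simp add: S_def)
      then have "t \<noteq> s" using dist r by auto
      moreover have "sgn (\<gamma> t - \<gamma> s) = u"
        using t \<open>\<gamma> s = x\<close> r u by (simp add: sgn_div_norm)
      ultimately show False using W(3)[OF s] t(1) by blast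
    qed
    then show ?thesis unfolding lies_off_def eventually_at_right_field
      using d(1) by (intro exI[of _ "min d 1"]) auto
  qed
  then show ?thesis using \<open>finite S\<close> B(1) by (intro exI[of _ "\<Union>s\<in>S. B s"]) auto
qed

text \<open>
  By local finiteness only finitely many boundary curves come near \<open>x\<close>.
\<close>

lemma eventually_ray_avoids_frontier:
  assumes "piecewise_smooth_boundary D"
  shows "\<exists>B. finite B \<and> (\<forall>u. norm u = 1 \<and> u \<notin> B \<longrightarrow> lies_off (frontier D) x u)"
proof -
  obtain \<C> where C: "\<And>C. C \<in> \<C> \<Longrightarrow> simple_piecewise_smooth_curve C" "locally_finite_in euclidean \<C>" "frontier D = \<Union>\<C>"
    using assms unfolding piecewise_smooth_boundary_def by blast
  have "x \<in> topspace euclidean" by simp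
  with C(2) have "\<exists>V. openin euclidean V \<and> x \<in> V \<and> finite {C \<in> \<C>. C \<inter> V \<noteq> {}}"
    unfolding locally_finite_in_def by blast
  then obtain V where V: "open V" "x \<in> V" "finite {C \<in> \<C>. C \<inter> V \<noteq> {}}"
    by (auto simp only: open_openin)
  obtain B where B: "\<And>C. C \<in> \<C> \<Longrightarrow> finite (B C)" "\<And>C u. C \<in> \<C> \<Longrightarrow> norm u = 1 \<Longrightarrow> u \<notin> B C \<Longrightarrow> lies_off C x u"
  proof -
    have "\<forall>C\<in>\<C>. \<exists>B. finite B \<and> (\<forall>u. norm u = 1 \<and> u \<notin> B \<longrightarrow> lies_off C x u)"
      using eventually_ray_avoids_curve C(1) by blast
    then obtain B where "\<forall>C\<in>\<C>. finite (B C) \<and> (\<forall>u. norm u = 1 \<and> u \<notin> B C \<longrightarrow> lies_off C x u)"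
      unfolding bchoice_iff by blast
    then show thesis by (intro that[of B]) auto
  qed
  have "lies_off (frontier D) x u" if u: "norm u = 1" "u \<notin> (\<Union>C\<in>{C \<in> \<C>. C \<inter> V \<noteq> {}}. B C)" for u
  proof -
    have "\<forall>\<^sub>F r in at_right 0. \<forall>C\<in>{C \<in> \<C>. C \<inter> V \<noteq> {}}. x + r *\<^sub>R u \<notin> C"
    proof (rule eventually_ball_finite[OF V(3)], rule ballI)
      fix C assume "C \<in> {C \<in> \<C>. C \<inter> V \<noteq> {}}"
      then have "lies_off C x u" using B(2)[of C u] u by blast
      then show "\<forall>\<^sub>F r in at_right 0. x + r *\<^sub>R u \<notin> C" by (simp add: lies_off_def)
    qed
    moreover have "((\<lambda>r. x + r *\<^sub>R u) \<longlongrightarrow> x + 0 *\<^sub>R u) (at_right 0)"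
      by (intro tendsto_intros)
    then have "\<forall>\<^sub>F r in at_right 0. x + r *\<^sub>R u \<in> V"
      using V(1,2) by (auto dest: topological_tendstoD)
    ultimately show ?thesis unfolding lies_off_def C(3)
      by eventually_elim auto
  qed
  then show ?thesis using V(3) B(1) by (intro exI[of _ "\<Union>C\<in>{C \<in> \<C>. C \<inter> V \<noteq> {}}. B C"]) auto
qed

text \<open>
  A short open piece of the ray is connected and does not meet the frontier, so it lies entirely
  inside or entirely outside \<open>D\<close>.
\<close>

lemma radial_limit_indicator:
  assumes "lies_off (frontier D) x u"
  shows "\<exists>c. ((\<lambda>r. indicator (closure D) (x + r *\<^sub>R u) :: 'a::{real_normed_algebra_1}) \<longlongrightarrow> c) (at_right 0)"
proof -
  obtain d where d: "d > 0" "\<And>r. 0 < r \<Longrightarrow> r < d \<Longrightarrow> x + r *\<^sub>R u \<notin> frontier D"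
    using assms unfolding lies_off_def eventually_at_right_field by auto
  define R where "R = (\<lambda>r. x + r *\<^sub>R u) ` {0<..<d}"
  have "connected R" unfolding R_def
    by (intro connected_continuous_image continuous_intros) auto
  moreover have "R \<inter> frontier D = {}" using d by (auto simp: R_def)
  ultimately have "R \<subseteq> D \<or> R \<inter> D = {}"
    using connected_Int_frontier[of R D] by blast
  then have "R \<subseteq> closure D \<or> R \<inter> closure D = {}"
    using \<open>R \<inter> frontier D = {}\<close> closure_subset[of D] interior_subset[of D] unfolding frontier_def by blast
  moreover have "\<forall>\<^sub>F r in at_right 0. x + r *\<^sub>R u \<in> R"
    unfolding eventually_at_right_field R_def using d(1) by (intro exI[of _ d]) auto
  ultimately show ?thesis
  proof (elim disjE)
    assume "R \<subseteq> closure D"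
    have "((\<lambda>r. indicator (closure D) (x + r *\<^sub>R u) :: 'a) \<longlongrightarrow> 1) (at_right 0)"
      by (rule tendsto_eventually, rule eventually_mono[OF \<open>\<forall>\<^sub>F r in _. _\<close>]) (use \<open>R \<subseteq> closure D\<close> in auto)
    then show ?thesis by blast
  next
    assume "R \<inter> closure D = {}"
    have "((\<lambda>r. indicator (closure D) (x + r *\<^sub>R u) :: 'a) \<longlongrightarrow> 0) (at_right 0)"
      by (rule tendsto_eventually, rule eventually_mono[OF \<open>\<forall>\<^sub>F r in _. _\<close>]) (use \<open>R \<inter> closure D = {}\<close> in \<open>auto simp: indicator_def\<close>)
    then show ?thesis by blast
  qed
qed

lemma closure_eq_Un_frontier: "D \<union> frontier D = closure D"
  by (metis closure_Un_frontier)

section \<open>Radial limits and circle averages of piecewise smooth functions\<close>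

text \<open>
  Together with measurability, this is all that the convergence of circle averages at \<open>x\<close> requires. Unlike
  the geometric description of a boundary, it is visibly preserved by linear combinations.
\<close>

definition radially_regular :: "(real \<times> real \<Rightarrow> complex) \<Rightarrow> real \<times> real \<Rightarrow> bool" where
  "radially_regular f x \<longleftrightarrow>
     (\<exists>M. \<forall>\<^sub>F y in nhds x. norm (f y) \<le> M) \<and>
     (\<exists>B. finite B \<and> (\<forall>u. norm u = 1 \<and> u \<notin> B \<longrightarrow> (\<exists>l. ((\<lambda>r. f (x + r *\<^sub>R u)) \<longlongrightarrow> l) (at_right 0))))"

lemma simple_piecewise_smooth_measurable:
  assumes "simple_piecewise_smooth f" shows "f \<in> borel_measurable borel"
proof -
  obtain F D where F: "\<And>x. F differentiable (at x)" and f: "f = (\<lambda>x. F x * indicator (closure D) x)"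
    using assms unfolding simple_piecewise_smooth_def closure_eq_Un_frontier by blast
  have [measurable]: "F \<in> borel_measurable borel"
    using F by (intro borel_measurable_continuous_onI) (simp add: continuous_at_imp_continuous_on differentiable_imp_continuous_within)
  show ?thesis unfolding f by measurable
qed

lemma simple_piecewise_smooth_regular:
  assumes "simple_piecewise_smooth f" shows "radially_regular f x"
proof -
  obtain F D where F: "\<And>x. F differentiable (at x)" and D: "piecewise_smooth_boundary D"
    and f: "f = (\<lambda>x. F x * indicator (closure D) x)"
    using assms unfolding simple_piecewise_smooth_def closure_eq_Un_frontier by blast
  have F_lim: "(F \<longlongrightarrow> F x) (nhds x)"
    using differentiable_imp_continuous_within[OF F[of x]] by (simp add: continuous_at tendsto_at_iff_tendsto_nhds)
  then have "\<forall>\<^sub>F y in nhds x. dist (F y) (F x) < 1"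
    by (rule tendstoD) simp
  then have "\<forall>\<^sub>F y in nhds x. norm (f y) \<le> norm (F x) + 1"
  proof eventually_elim
    case (elim y)
    have "norm (f y) \<le> norm (F y)" by (simp add: f indicator_def)
    also have "\<dots> \<le> norm (F x) + 1" using elim norm_triangle_ineq2[of "F y" "F x"] by (simp add: dist_norm)
    finally show ?case .
  qed
  moreover obtain B where B: "finite B" "\<And>u. norm u = 1 \<Longrightarrow> u \<notin> B \<Longrightarrow> lies_off (frontier D) x u"
    using eventually_ray_avoids_frontier[OF D] by metis
  have "\<exists>l. ((\<lambda>r. f (x + r *\<^sub>R u)) \<longlongrightarrow> l) (at_right 0)" if u: "norm u = 1" "u \<notin> B" for u
  proof -
    obtain c :: complex where c: "((\<lambda>r. indicator (closure D) (x + r *\<^sub>R u)) \<longlongrightarrow> c) (at_right 0)"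
      using radial_limit_indicator[OF B(2)[OF u]] by blast
    have "((\<lambda>r. x + r *\<^sub>R u) \<longlongrightarrow> x + 0 *\<^sub>R u) (at_right 0)"
      by (intro tendsto_intros)
    then have "((\<lambda>r. F (x + r *\<^sub>R u)) \<longlongrightarrow> F x) (at_right 0)"
      by (intro filterlim_compose[OF F_lim]) simp
    from tendsto_mult[OF this c] show ?thesis unfolding f by blast
  qed
  ultimately show ?thesis unfolding radially_regular_def using B(1) by blast
qed

lemma radially_regular_sum:
  assumes "\<And>i. i < n \<Longrightarrow> radially_regular (g i) x"
  shows "radially_regular (\<lambda>y. \<Sum>i<(n::nat). c i * g i y) x"
proof -
  obtain M B where M: "\<And>i. i < n \<Longrightarrow> \<forall>\<^sub>F y in nhds x. norm (g i y) \<le> M i"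
    and B: "\<And>i. i < n \<Longrightarrow> finite (B i)"
      "\<And>i u. i < n \<Longrightarrow> norm u = 1 \<Longrightarrow> u \<notin> B i \<Longrightarrow> \<exists>l. ((\<lambda>r. g i (x + r *\<^sub>R u)) \<longlongrightarrow> l) (at_right 0)"
    using assms unfolding radially_regular_def by metis
  have "\<forall>\<^sub>F y in nhds x. \<forall>i\<in>{..<n}. norm (g i y) \<le> M i"
    using M by (simp add: eventually_ball_finite_distrib)
  then have "\<forall>\<^sub>F y in nhds x. norm (\<Sum>i<n. c i * g i y) \<le> (\<Sum>i<n. norm (c i) * M i)"
    by eventually_elim (auto intro!: sum_norm_le mult_left_mono simp: norm_mult)
  moreover have "\<exists>l. ((\<lambda>r. \<Sum>i<n. c i * g i (x + r *\<^sub>R u)) \<longlongrightarrow> l) (at_right 0)"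
    if u: "norm u = 1" "u \<notin> (\<Union>i<n. B i)" for u
  proof -
    have "\<exists>l. \<forall>i<n. ((\<lambda>r. g i (x + r *\<^sub>R u)) \<longlongrightarrow> l i) (at_right 0)"
      using B(2) u by (intro choice) auto
    then obtain l where "\<And>i. i < n \<Longrightarrow> ((\<lambda>r. g i (x + r *\<^sub>R u)) \<longlongrightarrow> l i) (at_right 0)" by blast
    then have "((\<lambda>r. \<Sum>i<n. c i * g i (x + r *\<^sub>R u)) \<longlongrightarrow> (\<Sum>i<n. c i * l i)) (at_right 0)"
      by (intro tendsto_sum tendsto_mult tendsto_const) auto
    then show ?thesis by blast
  qed
  moreover have "finite (\<Union>i<n. B i)" using B(1) by auto
  ultimately show ?thesis unfolding radially_regular_def by blast
qed

lemma piecewise_smooth_measurable: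
  assumes "piecewise_smooth f" shows "f \<in> borel_measurable borel"
proof -
  obtain n c g where "\<And>i. i < n \<Longrightarrow> simple_piecewise_smooth (g i)" "f = (\<lambda>x. \<Sum>i<(n::nat). c i * g i x)"
    using assms unfolding piecewise_smooth_def by blast
  then show ?thesis
    by (auto intro!: borel_measurable_sum borel_measurable_times intro: simple_piecewise_smooth_measurable)
qed

lemma piecewise_smooth_regular:
  assumes "piecewise_smooth f" shows "radially_regular f x"
proof -
  obtain n c g where "\<And>i. i < n \<Longrightarrow> simple_piecewise_smooth (g i)" "f = (\<lambda>x. \<Sum>i<(n::nat). c i * g i x)"
    using assms unfolding piecewise_smooth_def by blast
  then show ?thesis
    using radially_regular_sum[of n g x c] simple_piecewise_smooth_regular by simp
qed

text \<open>
  The radial limits exist at all angles but countably many, and \<open>f\<close> is bounded near \<open>x\<close>, so the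
  circle averages converge by dominated convergence.
\<close>

lemma circle_average_converges:
  assumes [measurable]: "f \<in> borel_measurable borel" and reg: "radially_regular f x"
  shows "\<exists>L. ((\<lambda>r. circle_average r f x) \<longlongrightarrow> L) (at_right 0)"
proof -
  obtain M B where M: "\<forall>\<^sub>F y in nhds x. norm (f y) \<le> M" and B: "finite B"
    and lim: "\<And>u. norm u = 1 \<Longrightarrow> u \<notin> B \<Longrightarrow> \<exists>l. ((\<lambda>r. f (x + r *\<^sub>R u)) \<longlongrightarrow> l) (at_right 0)"
    using reg unfolding radially_regular_def by blast
  obtain d where d: "d > 0" "\<And>y. dist y x < d \<Longrightarrow> norm (f y) \<le> M"
    using M unfolding eventually_nhds_metric by blast
  define u where "u = (\<lambda>\<theta>. (cos \<theta>, sin \<theta>) :: real \<times> real)"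
  have norm_u: "norm (u \<theta>) = 1" for \<theta> by (simp add: u_def norm_prod_def)
  have [measurable]: "(\<lambda>\<theta>. x + r *\<^sub>R u \<theta>) \<in> borel_measurable borel" for r
    unfolding u_def by (intro borel_measurable_continuous_onI continuous_intros)
  \<comment> \<open>Taking the radial limit along one fixed sequence makes \<open>l\<close> evidently measurable.\<close>
  define l where "l = (\<lambda>\<theta>. lim (\<lambda>n. f (x + (1 / real (Suc n)) *\<^sub>R u \<theta>)))"
  have [measurable]: "l \<in> borel_measurable borel" unfolding l_def by measurable
  have inv_lim: "filterlim (\<lambda>n. 1 / real (Suc n)) (at_right 0) sequentially"
    by (rule tendsto_imp_filterlim_at_right) (use LIMSEQ_inverse_real_of_nat in \<open>auto simp: inverse_eq_divide\<close>)
  have l: "((\<lambda>r. f (x + r *\<^sub>R u \<theta>)) \<longlongrightarrow> l \<theta>) (at_right 0)" if good: "u \<theta> \<notin> B" for \<theta>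
  proof -
    obtain k where k: "((\<lambda>r. f (x + r *\<^sub>R u \<theta>)) \<longlongrightarrow> k) (at_right 0)" using lim[OF norm_u good] by blast
    then have "(\<lambda>n. f (x + (1 / real (Suc n)) *\<^sub>R u \<theta>)) \<longlonglongrightarrow> k"
      by (rule filterlim_compose[OF _ inv_lim])
    then have "l \<theta> = k" unfolding l_def by (rule limI)
    then show ?thesis using k by simp
  qed
  have "countable {\<theta>. u \<theta> \<in> B}"
  proof -
    have "countable {\<theta>. u \<theta> = b}" for b
    proof (cases "\<exists>\<theta>0. u \<theta>0 = b")
      case True
      then obtain \<theta>0 where "u \<theta>0 = b" by blast
      then have "{\<theta>. u \<theta> = b} \<subseteq> range (\<lambda>n::int. \<theta>0 + 2 * pi * of_int n)"
        using sin_cos_eq_iff by (auto simp: u_def image_def)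
      then show ?thesis by (rule countable_subset) simp
    qed simp
    moreover have "{\<theta>. u \<theta> \<in> B} = (\<Union>b\<in>B. {\<theta>. u \<theta> = b})" by auto
    ultimately show ?thesis using B by (simp add: countable_finite)
  qed
  then have AE_good: "AE \<theta> in lborel. u \<theta> \<notin> B"
    using AE_not_in[OF countable_imp_null_set_lborel] by fastforce
  define I where "I = (\<lambda>r. LINT \<theta>|lborel. indicator {0..2*pi} \<theta> *\<^sub>R f (x + r *\<^sub>R u \<theta>))"
  have "(I \<longlongrightarrow> (LINT \<theta>|lborel. indicator {0..2*pi} \<theta> *\<^sub>R l \<theta>)) (at_right 0)"
  proof (rule tendsto_at_right_sequentially[of 0 1])
    fix r :: "nat \<Rightarrow> real" assume r: "\<And>n. 0 < r n" "r \<longlonglongrightarrow> 0"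
    have r_lim: "filterlim r (at_right 0) sequentially"
      by (rule tendsto_imp_filterlim_at_right) (use r in auto)
    obtain N where N: "\<And>n. n \<ge> N \<Longrightarrow> r n < d"
      using order_tendstoD(2)[OF r(2) d(1)] unfolding eventually_sequentially by blast
    have "(\<lambda>n. I (r (n + N))) \<longlonglongrightarrow> (LINT \<theta>|lborel. indicator {0..2*pi} \<theta> *\<^sub>R l \<theta>)"
      unfolding I_def
    proof (rule integral_dominated_convergence[where w="\<lambda>\<theta>. indicator {0..2*pi} \<theta> * M"])
      show "AE \<theta> in lborel. (\<lambda>n. indicator {0..2*pi} \<theta> *\<^sub>R f (x + r (n + N) *\<^sub>R u \<theta>)) \<longlonglongrightarrow> indicator {0..2*pi} \<theta> *\<^sub>R l \<theta>"
        using AE_good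
      proof eventually_elim
        case (elim \<theta>)
        have "(\<lambda>n. f (x + r n *\<^sub>R u \<theta>)) \<longlonglongrightarrow> l \<theta>"
          by (rule filterlim_compose[OF l[OF elim] r_lim])
        then have "(\<lambda>n. f (x + r (n + N) *\<^sub>R u \<theta>)) \<longlonglongrightarrow> l \<theta>" by (rule LIMSEQ_ignore_initial_segment)
        then show ?case by (intro tendsto_scaleR tendsto_const)
      qed
      show "AE \<theta> in lborel. norm (indicator {0..2*pi} \<theta> *\<^sub>R f (x + r (n + N) *\<^sub>R u \<theta>)) \<le> indicator {0..2*pi} \<theta> * M" for n
      proof (rule AE_I2)
        fix \<theta>
        have "norm (f (x + r (n + N) *\<^sub>R u \<theta>)) \<le> M"
          using N[of "n + N"] r(1)[of "n + N"] norm_u[of \<theta>] by (intro d(2)) (simp add: dist_norm)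
        then show "norm (indicator {0..2*pi} \<theta> *\<^sub>R f (x + r (n + N) *\<^sub>R u \<theta>)) \<le> indicator {0..2*pi} \<theta> * M"
          by (simp add: indicator_def)
      qed
    qed auto
    then show "(\<lambda>n. I (r n)) \<longlonglongrightarrow> (LINT \<theta>|lborel. indicator {0..2*pi} \<theta> *\<^sub>R l \<theta>)"
      by (rule LIMSEQ_offset)
  qed simp
  from tendsto_mult_left[OF this, of "1 / (2 * complex_of_real pi)"] show ?thesis
    unfolding circle_average_eq[OF assms(1)] I_def u_def set_lebesgue_integral_def by blast
qed

section \<open>Convergence of the approximate inversion\<close>

theorem theorem1p1:
  fixes f :: "real \<times> real \<Rightarrow> complex"
  assumes "integrable lebesgue f"
    and "piecewise_smooth f"
  shows "\<forall>x. ((\<lambda>\<alpha>. A_op \<alpha> f x) \<longlongrightarrow> local_average f x) (at_right 0)"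
proof
  fix x
  have meas [measurable]: "f \<in> borel_measurable borel" by (rule piecewise_smooth_measurable) fact
  have f: "integrable lborel f" using assms(1) by (simp add: integrable_completion)
  have reg: "radially_regular f x" by (rule piecewise_smooth_regular) fact
  obtain L where L: "((\<lambda>r. circle_average r f x) \<longlongrightarrow> L) (at_right 0)"
    using circle_average_converges[OF meas reg] by blast
  obtain M where "\<forall>\<^sub>F y in nhds x. norm (f y) \<le> M" using reg unfolding radially_regular_def by blast
  then obtain d where d: "d > 0" "\<And>y. dist y x < d \<Longrightarrow> norm (f y) \<le> M"
    unfolding eventually_nhds_metric by blast
  have "filterlim norm (at_right 0) (at (0::real \<times> real))"
    by (rule tendsto_imp_filterlim_at_right) (auto simp: eventually_at_filter tendsto_norm_zero)
  from filterlim_compose[OF L this]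
  have "((\<lambda>z. circle_average (norm z) f x) \<longlongrightarrow> L) (at (0::real \<times> real))" .
  then have "(rotation_average f x \<longlongrightarrow> L) (at 0)"
  proof (rule Lim_transform_eventually)
    have "rotation_average f x z = circle_average (norm z) f x" if "norm z < d" for z
      by (rule rotation_average_eq_circle_average[OF meas, where M=M]) (use d that in \<open>auto simp: dist_norm\<close>)
    then show "\<forall>\<^sub>F z in at 0. circle_average (norm z) f x = rotation_average f x z"
      unfolding eventually_at using d(1) by (intro exI[of _ d]) (auto simp: dist_norm)
  qed
  then have "((\<lambda>\<alpha>. LINT z|lborel. complex_of_real (poisson_kernel \<alpha> z) * rotation_average f x z) \<longlongrightarrow> L) (at_right 0)"
    by (rule poisson_kernel_approximate_identity[OF integrable_rotation_average[OF f]])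
  then have "((\<lambda>\<alpha>. A_op \<alpha> f x) \<longlongrightarrow> L) (at_right 0)"
  proof (rule Lim_transform_eventually)
    show "\<forall>\<^sub>F \<alpha> in at_right 0. (LINT z|lborel. complex_of_real (poisson_kernel \<alpha> z) * rotation_average f x z) = A_op \<alpha> f x"
      using A_op_eq_rotation_average[OF _ f] by (auto simp: eventually_at_filter)
  qed
  moreover have "local_average f x = L"
    unfolding local_average_def by (rule tendsto_Lim[OF _ L]) simp
  ultimately show "((\<lambda>\<alpha>. A_op \<alpha> f x) \<longlongrightarrow> local_average f x) (at_right 0)" by simp
qed

end
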